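(* Let $1<p_1,\dots,p_m<\infty$, $\frac1p=\frac1{p_1}+\cdots+\frac1{p_m}$, and $0<p\le q<\infty$. Let $\mathcal{A}_i,\mathcal{B}_i,\mathcal{C}_i$ $(i=1,\dots,m)$ be Young functions such that $\mathcal{A}_i^{-1}(t)\,\mathcal{C}_i^{-1}(t)\le\mathcal{B}_i^{-1}(t)$ for all $t>0$ and each $i=1,\dots,m$. Let $\varphi:(0,\infty)\to(0,\infty)$ be essentially non-decreasing with $\lim_{t\to\infty}\varphi(t)/t=0$. Assume that $\mathscr{B}$ is a basis in $\mathbb{R}^n$ and that $\{\mathcal{C}_i\}_{i=1}^m$ satisfies $$\mathcal{M}_{\mathscr{B},\overrightarrow{\mathcal{C}}}:L^{p_1}(\mathbb{R}^n)\times\cdots\times L^{p_m}(\mathbb{R}^n)\to L^p(\mathbb{R}^n)\quad\text{boundedly}.$$ If $\vec w=(w_1,\dots,w_m)$ and $v$ are weights such that the condition $(A_{\mathscr{B},\gamma,v^q})$ holds for some $\gamma\in(0,1)$ and $$\sup_{B\in\mathscr{B}}\varphi(|B|)\,|B|^{\frac1q-\frac1p}\Big(\frac1{|B|}\int_Bv^q\,dx\Big)^{\frac1q}\prod_{i=1}^m\big\|w_i^{-1}\big\|_{\mathcal{A}_i,B}<\infty,$$ then $\mathcal{M}_{\mathscr{B},\varphi,\overrightarrow{\mathcal{B}}}$ is bounded from $L^{p_1}(w_1^{p_1})\times\cdots\times L^{p_m}(w_m^{p_m})$ to $L^q(v^q)$.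
   Context: A basis $\mathscr{B}$ in $\mathbb{R}^n$ is a collection of open sets in $\mathbb{R}^n$. A weight associated with $\mathscr{B}$ is a nonnegative measurable function $w$ with $w(B)=\int_Bw\,dx<\infty$ for each $B\in\mathscr{B}$; here $v^q$ is a weight associated with $\mathscr{B}$. The maximal operator of the basis is $M_{\mathscr{B}}f(x)=\sup_{B\in\mathscr{B},B\ni x}\frac1{|B|}\int_B|f(y)|dy$. A Young function is a continuous, convex, increasing $\Phi:[0,\infty)\to[0,\infty)$ with $\Phi(0)=0$ and $\Phi(t)\to\infty$ as $t\to\infty$. For a set $E$ of finite measure, $\|f\|_{\Phi,E}=\inf\{\lambda>0:\frac1{|E|}\int_E\Phi(|f(x)|/\lambda)dx\le1\}$. $\varphi$ essentially non-decreasing means that there is a constant $\rho>0$ with $\varphi(s)\le\rho\,\varphi(t)$ whenever $0<s\le t$. For Young functions $\overrightarrow\Psi=(\Psi_1,\dots,\Psi_m)$, $$\mathcal{M}_{\mathscr{B},\varphi,\overrightarrow\Psi}(\vec f)(x)=\sup_{B\in\mathscr{B},B\ni x}\varphi(|B|)\prod_{i=1}^m\|f_i\|_{\Psi_i,B},$$ and $\mathcal{M}_{\mathscr{B},\overrightarrow\Psi}$ denotes the same operator with $\varphi\equiv1$. Here $\overrightarrow{\mathcal{B}}=(\mathcal{B}_1,\dots,\mathcal{B}_m)$ and $\overrightarrow{\mathcal{C}}=(\mathcal{C}_1,\dots,\mathcal{C}_m)$. Tauberian condition $(A_{\mathscr{B},\gamma,\mu})$, for $\gamma\in(0,1)$ and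 a weight $\mu$: there is a positive constant $C_{\mathscr{B},\gamma,\mu}$ such that for all measurable sets $E$, $\mu(\{x\in\mathbb{R}^n:M_{\mathscr{B}}(\mathbf 1_E)(x)>\gamma\})\le C_{\mathscr{B},\gamma,\mu}\,\mu(E)$, where $\mu(E)=\int_E\mu\,dx$. Boundedness of $T$ from $L^{p_1}(w_1^{p_1})\times\cdots\times L^{p_m}(w_m^{p_m})$ to $L^q(v^q)$ means $\big(\int|T(\vec f)|^qv^q\,dx\big)^{1/q}\le C\prod_{i=1}^m\big(\int|f_i|^{p_i}w_i^{p_i}dx\big)^{1/p_i}$ for all $\vec f$, with $C$ independent of $\vec f$. *)

theory Defs
  imports "HOL-Analysis.Analysis"
begin

text \<open>Averages, suprema and norms take values in \<open>ennreal\<close>, with the usual convention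
  \<open>0 * \<infinity> = 0\<close>. Functions and weights are Lebesgue measurable and finite-valued.\<close>

text \<open>Finite measure is what makes the averages, the Orlicz norms and \<open>\<phi> |B|\<close> meaningful. The empty
  set is not excluded: it contains no point, and its Orlicz norms below are \<open>0\<close>.\<close>

definition basis :: "'a::euclidean_space set set \<Rightarrow> bool" where
  "basis \<B> \<longleftrightarrow> (\<forall>B\<in>\<B>. open B \<and> emeasure lebesgue B < \<infinity>)"

definition weight :: "'a::euclidean_space set set \<Rightarrow> ('a \<Rightarrow> real) \<Rightarrow> bool" where
  "weight \<B> w \<longleftrightarrow> w \<in> borel_measurable lebesgue \<and> (\<forall>x. 0 \<le> w x) \<and>
     (\<forall>B\<in>\<B>. (\<integral>\<^sup>+x\<in>B. ennreal (w x) \<partial>lebesgue) < \<infinity>)"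

definition avg :: "('a::euclidean_space \<Rightarrow> ennreal) \<Rightarrow> 'a set \<Rightarrow> ennreal" where
  "avg f B = (\<integral>\<^sup>+x\<in>B. f x \<partial>lebesgue) / emeasure lebesgue B"

definition maximal_op :: "'a::euclidean_space set set \<Rightarrow> ('a \<Rightarrow> real) \<Rightarrow> 'a \<Rightarrow> ennreal" where
  "maximal_op \<B> f x = (SUP B\<in>{B\<in>\<B>. x \<in> B}. avg (\<lambda>y. ennreal \<bar>f y\<bar>) B)"

text \<open>Only the values on \<open>[0,\<infinity>)\<close> matter. ``Increasing'' is read as non-decreasing, which also admits
  functions vanishing near \<open>0\<close>.\<close>

definition young_function :: "(real \<Rightarrow> real) \<Rightarrow> bool" where
  "young_function \<Phi> \<longleftrightarrow> continuous_on {0..} \<Phi> \<and> convex_on {0..} \<Phi> \<and> mono_on {0..} \<Phi> \<and>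
     (\<forall>t\<ge>0. 0 \<le> \<Phi> t) \<and> \<Phi> 0 = 0 \<and> filterlim \<Phi> at_top at_top"

text \<open>\<open>\<Phi>\<^sup>-\<^sup>1(t)\<close> is rendered as \<open>the_inv_into {0..} \<Phi> t\<close>. Even when \<open>\<Phi>\<close> is not injective on
  \<open>[0,\<infinity>)\<close>, convexity makes the preimage of every \<open>t > 0\<close> unique:\<close>

lemma young_function_unique_preimage:
  assumes "young_function \<Phi>" and "t > 0"
  shows "\<exists>!s. s \<in> {0..} \<and> \<Phi> s = t"
proof -
  have cont: "continuous_on {0..} \<Phi>" and conv: "convex_on {0..} \<Phi>" and z: "\<Phi> 0 = 0"
    and lim: "filterlim \<Phi> at_top at_top"
    using assms(1) by (auto simp: young_function_def)
  from lim have "eventually (\<lambda>s. \<Phi> s \<ge> t) at_top"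
    by (simp add: filterlim_at_top)
  then obtain b where b: "\<And>s. s \<ge> b \<Longrightarrow> \<Phi> s \<ge> t"
    by (auto simp: eventually_at_top_linorder)
  have "\<exists>s\<ge>0. s \<le> max 0 b \<and> \<Phi> s = t"
    using b[of "max 0 b"] z assms(2)
    by (intro IVT' continuous_on_subset[OF cont]) auto
  moreover have False if "0 \<le> r" "r < s" "\<Phi> r = t" "\<Phi> s = t" for r s
  proof -
    have "\<Phi> ((1 - r/s) *\<^sub>R 0 + (r/s) *\<^sub>R s) \<le> (1 - r/s) * \<Phi> 0 + (r/s) * \<Phi> s"
      using that by (intro convex_onD[OF conv]) (auto simp: field_simps)
    then have "t \<le> (r/s) * t" using that z by simp
    moreover have "(r/s) * t < 1 * t"
      using that assms(2) by (intro mult_strict_right_mono) (auto simp: field_simps)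
    ultimately show False by simp
  qed
  ultimately show ?thesis
    by (metis atLeast_iff linorder_neqE_linordered_idom)
qed

definition young_ext :: "(real \<Rightarrow> real) \<Rightarrow> ennreal \<Rightarrow> ennreal" where
  "young_ext \<Phi> t = (if t = \<infinity> then \<infinity> else ennreal (\<Phi> (enn2real t)))"

text \<open>The argument is an \<open>ennreal\<close>-valued function so that the norm applies to reciprocals of weights,
  which are infinite where the weight vanishes.\<close>

definition orlicz_norm :: "(real \<Rightarrow> real) \<Rightarrow> ('a::euclidean_space \<Rightarrow> ennreal) \<Rightarrow> 'a set \<Rightarrow> ennreal" where
  "orlicz_norm \<Phi> f E =
     Inf {ennreal c | c. c > 0 \<and> avg (\<lambda>x. young_ext \<Phi> (f x / ennreal c)) E \<le> 1}"

definition ess_nondecreasing :: "(real \<Rightarrow> real) \<Rightarrow> bool" where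
  "ess_nondecreasing \<phi> \<longleftrightarrow> (\<exists>\<rho>>0. \<forall>s t. 0 < s \<and> s \<le> t \<longrightarrow> \<phi> s \<le> \<rho> * \<phi> t)"

text \<open>The finite type \<open>'m\<close> indexes the \<open>m\<close> components.\<close>

definition multi_maximal ::
  "'a::euclidean_space set set \<Rightarrow> (real \<Rightarrow> real) \<Rightarrow> ('m::finite \<Rightarrow> real \<Rightarrow> real) \<Rightarrow>
   ('m \<Rightarrow> 'a \<Rightarrow> real) \<Rightarrow> 'a \<Rightarrow> ennreal" where
  "multi_maximal \<B> \<phi> \<Psi> f x =
     (SUP B\<in>{B\<in>\<B>. x \<in> B}. ennreal (\<phi> (measure lebesgue B)) *
        (\<Prod>i\<in>UNIV. orlicz_norm (\<Psi> i) (\<lambda>y. ennreal \<bar>f i y\<bar>) B))"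

definition tauberian :: "'a::euclidean_space set set \<Rightarrow> real \<Rightarrow> ('a \<Rightarrow> real) \<Rightarrow> bool" where
  "tauberian \<B> \<gamma> \<mu> \<longleftrightarrow> (\<exists>C>0. \<forall>E\<in>sets lebesgue.
     (\<integral>\<^sup>+x\<in>{x. maximal_op \<B> (indicator E) x > ennreal \<gamma>}. ennreal (\<mu> x) \<partial>lebesgue)
       \<le> ennreal C * (\<integral>\<^sup>+x\<in>E. ennreal (\<mu> x) \<partial>lebesgue))"

text \<open>Intended for exponents \<open>a > 0\<close> only, where \<open>\<infinity>\<close> is mapped to \<open>\<infinity>\<close>.\<close>

definition ennreal_pow :: "ennreal \<Rightarrow> real \<Rightarrow> ennreal" where
  "ennreal_pow x a = (if x = \<infinity> then \<infinity> else ennreal (enn2real x powr a))"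

definition wnorm :: "('a::euclidean_space \<Rightarrow> real) \<Rightarrow> real \<Rightarrow> ('a \<Rightarrow> ennreal) \<Rightarrow> ennreal" where
  "wnorm w r f = ennreal_pow (\<integral>\<^sup>+x. ennreal_pow (f x) r * ennreal (w x powr r) \<partial>lebesgue) (1 / r)"

text \<open>Boundedness of \<open>T\<close> from \<open>\<Prod>i. L\<^bsup>P i\<^esup>(w\<^sub>i\<^bsup>P i\<^esup>)\<close> to \<open>L\<^bsup>q\<^esup>(v\<^bsup>q\<^esup>)\<close>.\<close>

definition multi_bounded ::
  "(('m::finite \<Rightarrow> 'a::euclidean_space \<Rightarrow> real) \<Rightarrow> 'a \<Rightarrow> ennreal) \<Rightarrow>
   ('m \<Rightarrow> real) \<Rightarrow> ('m \<Rightarrow> 'a \<Rightarrow> real) \<Rightarrow> real \<Rightarrow> ('a \<Rightarrow> real) \<Rightarrow> bool" where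
  "multi_bounded T P w q v \<longleftrightarrow> (\<exists>C\<ge>0. \<forall>f. (\<forall>i. f i \<in> borel_measurable lebesgue) \<longrightarrow>
     wnorm v q (T f) \<le> ennreal C * (\<Prod>i\<in>UNIV. wnorm (w i) (P i) (\<lambda>x. ennreal \<bar>f i x\<bar>)))"

end

theory Submission
  imports Defs
begin

text \<open>Put \<open>l(B) = (\<phi>(|B|) \<Prod>\<^sub>i \<parallel>f\<^sub>i\<parallel>)\<^sup>q\<close> and take a finite subfamily of the basis. Going through it
  in decreasing order of \<open>l\<close>, select \<open>B\<close> unless more than the fraction \<open>\<gamma>\<close> of it is covered by the sets
  selected before; removing that part from \<open>B\<close> leaves pairwise disjoint sets \<open>E\<^sub>B\<close> with
  \<open>|E\<^sub>B| \<ge> (1 - \<gamma>) |B|\<close>. Every member with \<open>l(B) > t\<close> lies in \<open>{M 1\<^sub>G > \<gamma>}\<close>, where \<open>G\<close> is the union of the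
  selected sets with \<open>l > t\<close>. The Tauberian condition thus compares distribution functions, so that the
  \<open>q\<close>-th power of the maximal function has \<open>v\<^sup>q\<close>-integral at most a constant times \<open>\<Sum> l(B) v\<^sup>q(B)\<close> over
  the selected sets. Hoelder's inequality for Orlicz norms and the weight condition bound each term by a
  multiple of \<open>(|B| \<Prod>\<^sub>i \<parallel>f\<^sub>i w\<^sub>i\<parallel>\<^sup>p)\<^bsup>q/p\<^esup>\<close>; as \<open>q/p \<ge> 1\<close>, disjointness of the \<open>E\<^sub>B\<close> reduces the sum to the
  assumed bound for the operator with \<open>\<C>\<^sub>i\<close>. Lindeloef's property and monotone convergence pass from
  finite subfamilies to the whole basis.\<close>

subsection \<open>Real powers of extended nonnegative reals\<close>

lemma ennreal_pow_ennreal [simp]: "0 \<le> x \<Longrightarrow> ennreal_pow (ennreal x) a = ennreal (x powr a)"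
  by (simp add: ennreal_pow_def)

lemma ennreal_pow_0 [simp]: "ennreal_pow 0 a = 0"
  by (simp add: ennreal_pow_def)

lemma ennreal_pow_top [simp]: "ennreal_pow top a = top"
  by (simp add: ennreal_pow_def)

lemma ennreal_pow_1 [simp]: "ennreal_pow x 1 = x"
  by (cases x) auto

lemma ennreal_pow_pow: "ennreal_pow (ennreal_pow x a) b = ennreal_pow x (a * b)"
  by (cases x) (auto simp: powr_powr)

lemma ennreal_pow_mono:
  assumes "0 \<le> a" "x \<le> y"
  shows "ennreal_pow x a \<le> ennreal_pow y a"
  using assms by (cases x; cases y) (auto simp: powr_mono2 top_unique)

lemma ennreal_pow_eq_0_iff [simp]: "ennreal_pow x a = 0 \<longleftrightarrow> x = 0"
  by (cases x) auto

lemma ennreal_pow_eq_top_iff [simp]: "ennreal_pow x a = top \<longleftrightarrow> x = top"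
  by (cases x) auto

lemma ennreal_pow_mult: "ennreal_pow (x * y) a = ennreal_pow x a * ennreal_pow y a"
proof (cases x)
  case (real r)
  then show ?thesis
    by (cases y) (auto simp: powr_mult ennreal_mult[symmetric] ennreal_mult_top)
next
  case top
  then show ?thesis
    by (cases "y = 0") (auto simp: ennreal_top_mult)
qed

text \<open>For \<open>a > 0\<close> the power has the monotone inverse with exponent
  \<open>1 / a\<close>, so each \<open>f i\<close> lies below the \<open>1 / a\<close>-th power of
  the right-hand side.\<close>

lemma ennreal_pow_SUP_le:
  assumes "0 < a"
  shows "ennreal_pow (SUP i\<in>I. f i) a \<le> (SUP i\<in>I. ennreal_pow (f i) a)"
proof -
  have "f i \<le> ennreal_pow (SUP i\<in>I. ennreal_pow (f i) a) (1 / a)" if "i \<in> I" for i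
  proof -
    have "ennreal_pow (ennreal_pow (f i) a) (1 / a) \<le> ennreal_pow (SUP i\<in>I. ennreal_pow (f i) a) (1 / a)"
      using assms that by (intro ennreal_pow_mono SUP_upper) auto
    then show ?thesis using assms by (simp add: ennreal_pow_pow)
  qed
  then have "ennreal_pow (SUP i\<in>I. f i) a
      \<le> ennreal_pow (ennreal_pow (SUP i\<in>I. ennreal_pow (f i) a) (1 / a)) a"
    using assms by (intro ennreal_pow_mono SUP_least) auto
  then show ?thesis using assms by (simp add: ennreal_pow_pow)
qed

text \<open>In \<open>t powr a = t * t powr (a - 1)\<close> the second factor is non-decreasing
  because \<open>1 \<le> a\<close>, so it may be replaced by its value at \<open>r + s\<close> in
  both terms.\<close>

lemma ennreal_pow_superadditive:
  assumes "1 \<le> a"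
  shows "ennreal_pow x a + ennreal_pow y a \<le> ennreal_pow (x + y) a"
proof (cases "x = top \<or> y = top")
  case False
  then obtain r s where rs: "x = ennreal r" "y = ennreal s" "0 \<le> r" "0 \<le> s"
    by (metis ennreal_cases)
  have split: "t powr a = t * t powr (a - 1)" if "0 \<le> t" for t
    using that powr_mult_base[of t "a - 1"] by simp
  have "r powr a + s powr a \<le> r * (r + s) powr (a - 1) + s * (r + s) powr (a - 1)"
    unfolding split[OF rs(3)] split[OF rs(4)] using rs assms
    by (intro add_mono mult_left_mono powr_mono2) auto
  also have "\<dots> = (r + s) powr a"
    using split[of "r + s"] rs by (simp add: distrib_right)
  finally show ?thesis
    using rs by (simp add: ennreal_plus[symmetric] del: ennreal_plus)
qed auto

lemma sum_ennreal_pow_le: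
  assumes "1 \<le> a" "finite S"
  shows "(\<Sum>i\<in>S. ennreal_pow (f i) a) \<le> ennreal_pow (\<Sum>i\<in>S. f i) a"
  using assms(2)
proof induction
  case (insert i S)
  then show ?case
    by (auto intro!: order_trans[OF _ ennreal_pow_superadditive[OF assms(1)]] add_left_mono)
qed simp

subsection \<open>Young functions and Orlicz norms\<close>

lemma young_function_preimage:
  assumes "young_function \<Phi>" and "t > 0"
  shows "0 \<le> the_inv_into {0..} \<Phi> t" and "\<Phi> (the_inv_into {0..} \<Phi> t) = t"
proof -
  have "the_inv_into {0..} \<Phi> t \<in> {0..} \<and> \<Phi> (the_inv_into {0..} \<Phi> t) = t"
    unfolding the_inv_into_def by (rule theI'[OF young_function_unique_preimage[OF assms]])
  then show "0 \<le> the_inv_into {0..} \<Phi> t" and "\<Phi> (the_inv_into {0..} \<Phi> t) = t" by auto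
qed

lemma young_function_mono: "young_function \<Phi> \<Longrightarrow> 0 \<le> x \<Longrightarrow> x \<le> y \<Longrightarrow> \<Phi> x \<le> \<Phi> y"
  by (auto simp: young_function_def mono_on_def)

lemma young_function_nonneg: "young_function \<Phi> \<Longrightarrow> 0 \<le> x \<Longrightarrow> 0 \<le> \<Phi> x"
  by (auto simp: young_function_def)

lemma young_function_scale:
  assumes "young_function \<Phi>" "0 \<le> c" "c \<le> 1" "0 \<le> x"
  shows "\<Phi> (c * x) \<le> c * \<Phi> x"
proof -
  have "convex_on {0..} \<Phi>" "\<Phi> 0 = 0" using assms(1) by (auto simp: young_function_def)
  then show ?thesis
    using convex_onD[of "{0..}" \<Phi> c 0 x] assms by simp
qed

text \<open>A point beyond the preimage of \<open>t\<close> would have value at least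
  \<open>t\<close> by monotonicity, hence exactly \<open>t\<close>, against the uniqueness of
  preimages of positive values.\<close>

lemma le_the_inv_into:
  assumes "young_function \<Phi>" "t > 0" "0 \<le> x" "\<Phi> x \<le> t"
  shows "x \<le> the_inv_into {0..} \<Phi> t"
proof (rule ccontr)
  note inv = young_function_preimage[OF assms(1,2)]
  assume "\<not> ?thesis"
  then have "the_inv_into {0..} \<Phi> t < x" by simp
  moreover from this have "\<Phi> x = t"
    using young_function_mono[OF assms(1) inv(1), of x] inv assms by simp
  ultimately show False
    using young_function_unique_preimage[OF assms(1,2)] inv assms(3) by (metis atLeast_iff less_irrefl)
qed

text \<open>Turns the condition on inverse functions into a Young-type inequality: \<open>x\<close>
  and \<open>y\<close> lie below the inverses of \<open>A\<close> and \<open>C\<close> at a common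
  level \<open>t\<close>, so \<open>B\<close> maps their product to at most
  \<open>t\<close>.\<close>

lemma young_function_mult_le:
  assumes Y: "young_function A" "young_function B" "young_function C"
    and inv: "\<And>t. t > 0 \<Longrightarrow>
      the_inv_into {0..} A t * the_inv_into {0..} C t \<le> the_inv_into {0..} B t"
    and "0 \<le> x" "0 \<le> y"
  shows "B (x * y) \<le> A x + C y"
proof (rule field_le_epsilon)
  fix e :: real assume "0 < e"
  \<comment> \<open>The summand \<open>e\<close> keeps the level positive even when
    \<open>A x\<close> and \<open>C y\<close> both vanish; the condition on inverses speaks of
    positive levels only.\<close>
  define t where "t = A x + C y + e"
  have nn: "0 \<le> A x" "0 \<le> C y" using Y assms(5,6) by (auto intro: young_function_nonneg)
  then have t: "t > 0" "A x \<le> t" "C y \<le> t" using \<open>0 < e\<close> by (auto simp: t_def)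
  have "x * y \<le> the_inv_into {0..} A t * the_inv_into {0..} C t"
    using t assms(5,6) Y by (intro mult_mono le_the_inv_into young_function_preimage(1)) auto
  also have "\<dots> \<le> the_inv_into {0..} B t" by (rule inv[OF t(1)])
  finally have "B (x * y) \<le> B (the_inv_into {0..} B t)"
    using assms(5,6) by (intro young_function_mono[OF Y(2)]) auto
  then show "B (x * y) \<le> A x + C y + e"
    using young_function_preimage(2)[OF Y(2) t(1)] by (simp add: t_def)
qed

lemma borel_measurable_young_ext [measurable (raw)]:
  assumes Y: "young_function \<Phi>" and [measurable]: "f \<in> borel_measurable M"
  shows "(\<lambda>x. young_ext \<Phi> (f x)) \<in> borel_measurable M"
proof -
  \<comment> \<open>Continuity is known on the half-line only; composing with \<open>max 0\<close>
    gives a continuous function on the whole line that agrees with \<open>\<Phi>\<close>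
    there.\<close>
  have "continuous_on {0..} \<Phi>" using Y by (simp add: young_function_def)
  then have "continuous_on UNIV (\<lambda>t. \<Phi> (max 0 t))"
    by (rule continuous_on_compose2) (auto intro!: continuous_intros)
  then have [measurable]: "(\<lambda>t. \<Phi> (max 0 t)) \<in> borel_measurable borel"
    by (rule borel_measurable_continuous_onI)
  have "(\<lambda>x. young_ext \<Phi> (f x)) =
      (\<lambda>x. if f x = \<infinity> then \<infinity> else ennreal (\<Phi> (max 0 (enn2real (f x)))))"
    by (auto simp: young_ext_def max_def)
  also have "\<dots> \<in> borel_measurable M"
    by measurable
  finally show ?thesis .
qed

lemma young_ext_mono:
  assumes "young_function \<Phi>" "s \<le> t"
  shows "young_ext \<Phi> s \<le> young_ext \<Phi> t"
proof (cases "t = \<infinity>")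
  case False
  then have "s \<noteq> \<infinity>" "enn2real s \<le> enn2real t"
    using assms(2) by (auto simp: top_unique less_top intro: enn2real_mono)
  then show ?thesis
    using False young_function_mono[OF assms(1), of "enn2real s" "enn2real t"]
    by (simp add: young_ext_def ennreal_leI)
qed (simp add: young_ext_def)

lemma avg_mono: "(\<And>x. x \<in> E \<Longrightarrow> f x \<le> g x) \<Longrightarrow> avg f E \<le> avg g E"
  unfolding avg_def by (intro divide_right_mono_ennreal nn_integral_mono) (auto simp: indicator_def)

text \<open>Pointwise form of Hoelder's inequality. By convexity and \<open>B 0 = 0\<close>, the
  factor 2 in the denominator pulls a factor 1/2 out of \<open>B\<close>, which leaves an arithmetic
  mean. Where \<open>h\<close> or \<open>g\<close> is infinite, so is the right-hand side.\<close>

lemma young_ext_mult_le: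
  assumes Y: "young_function A" "young_function B" "young_function C"
    and inv: "\<And>t. t > 0 \<Longrightarrow>
      the_inv_into {0..} A t * the_inv_into {0..} C t \<le> the_inv_into {0..} B t"
    and fhg: "h = \<infinity> \<or> g = \<infinity> \<or> f \<le> h * g" and ac: "0 < a" "0 < c"
  shows "young_ext B (f / ennreal (2 * a * c))
    \<le> (young_ext A (h / ennreal a) + young_ext C (g / ennreal c)) / 2"
proof (cases "h = \<infinity> \<or> g = \<infinity>")
  case True
  then show ?thesis using ac by (auto simp: young_ext_def ennreal_top_divide)
next
  case False
  then obtain x y where xy: "h = ennreal x" "g = ennreal y" "0 \<le> x" "0 \<le> y"
    by (metis ennreal_cases infinity_ennreal_def)
  have "f / ennreal (2 * a * c) \<le> ennreal (x * y) / ennreal (2 * a * c)"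
    using fhg False xy by (intro divide_right_mono_ennreal) (auto simp: ennreal_mult)
  also have "\<dots> = ennreal ((1/2) * ((x / a) * (y / c)))"
    using xy ac by (simp add: divide_ennreal)
  finally have "young_ext B (f / ennreal (2 * a * c)) \<le> young_ext B (ennreal ((1/2) * ((x / a) * (y / c))))"
    by (rule young_ext_mono[OF Y(2)])
  also have "\<dots> = ennreal (B ((1/2) * ((x / a) * (y / c))))"
    using xy ac by (simp add: young_ext_def del: times_divide_eq_left times_divide_eq_right)
  also have "\<dots> \<le> ennreal ((1/2) * (A (x / a) + C (y / c)))"
  proof (rule ennreal_leI)
    have "B ((1/2) * ((x / a) * (y / c))) \<le> (1/2) * B ((x / a) * (y / c))"
      using xy ac by (intro young_function_scale[OF Y(2)]) auto
    also have "\<dots> \<le> (1/2) * (A (x / a) + C (y / c))"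
      using xy ac by (intro mult_left_mono young_function_mult_le[OF Y inv]) auto
    finally show "B ((1/2) * ((x / a) * (y / c))) \<le> (1/2) * (A (x / a) + C (y / c))" .
  qed
  also have "\<dots> = (young_ext A (h / ennreal a) + young_ext C (g / ennreal c)) / 2"
    using xy ac young_function_nonneg[OF Y(1), of "x/a"] young_function_nonneg[OF Y(3), of "y/c"]
    by (simp add: young_ext_def divide_ennreal ennreal_plus[symmetric] ennreal_divide_numeral
        del: ennreal_plus)
  finally show ?thesis .
qed

text \<open>For \<open>k\<close> neither zero nor infinite, divide by \<open>k\<close>. The side
  conditions exclude the two products of zero and infinity: \<open>k = 0\<close> with
  \<open>Inf {} = top\<close>, and \<open>k = top\<close> with \<open>Inf S = 0\<close>.\<close>

lemma ennreal_mult_Inf_le: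
  fixes N k :: ennreal
  assumes N: "\<And>c. c \<in> S \<Longrightarrow> N \<le> k * c" and "k \<noteq> 0 \<or> S \<noteq> {}" "k \<noteq> top \<or> Inf S \<noteq> 0"
  shows "N \<le> k * Inf S"
proof (cases "k = 0 \<or> k = top")
  case True
  then show ?thesis using assms by (fastforce simp: ennreal_top_mult)
next
  case False
  then have "N / k \<le> Inf S"
    using N by (intro Inf_greatest divide_le_posI_ennreal) (auto simp: mult.commute zero_less_iff_neq_zero)
  then have "k * (N / k) \<le> k * Inf S" by (rule mult_left_mono) simp
  then show ?thesis using False by (simp add: ennreal_times_divide mult_divide_eq_ennreal mult.commute)
qed

lemma orlicz_norm_le:
  "0 < c \<Longrightarrow> avg (\<lambda>x. young_ext \<Phi> (f x / ennreal c)) E \<le> 1 \<Longrightarrow> orlicz_norm \<Phi> f E \<le> ennreal c"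
  unfolding orlicz_norm_def by (auto intro: Inf_lower)

text \<open>If \<open>a\<close> and \<open>c\<close> are admissible in the infima defining the norms
  of \<open>h\<close> and \<open>g\<close>, then \<open>2 * a * c\<close> is admissible for
  \<open>f\<close>, because the mean of two numbers at most 1 is at most 1. The infimum is taken
  first over \<open>c\<close>, then over \<open>a\<close>.\<close>

lemma orlicz_norm_holder:
  fixes E :: "'a::euclidean_space set"
  assumes Y: "young_function A" "young_function B" "young_function C"
    and inv: "\<And>t. t > 0 \<Longrightarrow>
      the_inv_into {0..} A t * the_inv_into {0..} C t \<le> the_inv_into {0..} B t"
    and [measurable]: "h \<in> borel_measurable lebesgue" "g \<in> borel_measurable lebesgue" "E \<in> sets lebesgue"
    and fhg: "\<And>x. x \<in> E \<Longrightarrow> h x = \<infinity> \<or> g x = \<infinity> \<or> f x \<le> h x * g x"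
    and pos: "orlicz_norm A h E \<noteq> 0" and fin: "orlicz_norm A h E \<noteq> \<infinity>"
  shows "orlicz_norm B f E \<le> 2 * orlicz_norm A h E * orlicz_norm C g E"
proof -
  have le: "orlicz_norm B f E \<le> ennreal (2 * a * c)"
    if a: "0 < a" "avg (\<lambda>x. young_ext A (h x / ennreal a)) E \<le> 1"
      and c: "0 < c" "avg (\<lambda>x. young_ext C (g x / ennreal c)) E \<le> 1" for a c
  proof (rule orlicz_norm_le)
    note [measurable] = borel_measurable_young_ext[OF Y(1)] borel_measurable_young_ext[OF Y(3)]
    have "avg (\<lambda>x. young_ext B (f x / ennreal (2 * a * c))) E
      \<le> avg (\<lambda>x. (young_ext A (h x / ennreal a) + young_ext C (g x / ennreal c)) / 2) E"
      using a c fhg by (intro avg_mono young_ext_mult_le[OF Y inv]) auto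
    also have "\<dots> = (avg (\<lambda>x. young_ext A (h x / ennreal a)) E
        + avg (\<lambda>x. young_ext C (g x / ennreal c)) E) / 2"
    proof -
      have "(\<integral>\<^sup>+x\<in>E. (young_ext A (h x / ennreal a) + young_ext C (g x / ennreal c)) / 2 \<partial>lebesgue)
        = (\<integral>\<^sup>+x. (young_ext A (h x / ennreal a) * indicator E x
            + young_ext C (g x / ennreal c) * indicator E x) / 2 \<partial>lebesgue)"
        by (intro nn_integral_cong) (auto simp: indicator_def)
      also have "\<dots> = ((\<integral>\<^sup>+x\<in>E. young_ext A (h x / ennreal a) \<partial>lebesgue)
            + (\<integral>\<^sup>+x\<in>E. young_ext C (g x / ennreal c) \<partial>lebesgue)) / 2"
        by (simp add: nn_integral_divide nn_integral_add)
      finally show ?thesis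
        by (simp add: avg_def divide_ennreal_def distrib_left distrib_right mult_ac)
    qed
    also have "\<dots> \<le> (1 + 1) / 2"
      using a c by (intro divide_right_mono_ennreal add_mono) auto
    finally show "avg (\<lambda>x. young_ext B (f x / ennreal (2 * a * c))) E \<le> 1"
      by simp
  qed (use a c in simp)
  let ?C = "{ennreal c | c. c > 0 \<and> avg (\<lambda>x. young_ext C (g x / ennreal c)) E \<le> 1}"
  let ?A = "{ennreal c | c. c > 0 \<and> avg (\<lambda>x. young_ext A (h x / ennreal c)) E \<le> 1}"
  have "orlicz_norm B f E \<le> (2 * orlicz_norm C g E) * a" if "a \<in> ?A" for a
  proof -
    have "orlicz_norm B f E \<le> 2 * a * Inf ?C"
      using that le by (intro ennreal_mult_Inf_le) (auto simp: ennreal_mult ennreal_mult_eq_top_iff)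
    then show ?thesis by (simp add: orlicz_norm_def mult_ac)
  qed
  \<comment> \<open>An admissible \<open>a\<close> settles the case where the norm of
    \<open>g\<close> is zero; \<open>pos\<close> settles the case where it is infinite.\<close>
  moreover have "?A \<noteq> {}"
    using fin unfolding orlicz_norm_def by (intro notI) (simp only: Inf_empty infinity_ennreal_def)
  ultimately have "orlicz_norm B f E \<le> 2 * orlicz_norm C g E * Inf ?A"
    using pos unfolding orlicz_norm_def[of A] by (intro ennreal_mult_Inf_le) auto
  then show ?thesis by (simp add: orlicz_norm_def[of A] mult_ac)
qed

text \<open>A Young function dominates a linear function away from \<open>0\<close>, so its norm controls averages.\<close>

lemma avg_le_orlicz_norm:
  assumes Y: "young_function \<Phi>"
  obtains K where "0 < K" "\<And>(f::'a::euclidean_space \<Rightarrow> ennreal) (E::'a set).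
    \<lbrakk>f \<in> borel_measurable lebesgue; E \<in> sets lebesgue; emeasure lebesgue E < \<infinity>\<rbrakk>
      \<Longrightarrow> avg f E \<le> ennreal K * orlicz_norm \<Phi> f E"
proof -
  \<comment> \<open>\<open>s\<close> is the point where \<open>\<Phi>\<close> takes the value 1.
    Beyond it, convexity gives \<open>x \<le> s * \<Phi> x\<close>; up to it,
    \<open>x \<le> s\<close>. The sum of the two bounds holds everywhere.\<close>
  define s where "s = the_inv_into {0..} \<Phi> 1"
  have s: "0 \<le> s" "\<Phi> s = 1" using young_function_preimage[OF Y, of 1] by (auto simp: s_def)
  moreover have "\<Phi> 0 = 0" using Y by (simp add: young_function_def)
  ultimately have "0 < s" by (cases "s = 0") auto
  have real_bound: "x \<le> s * (1 + \<Phi> x)" if "0 \<le> x" for x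
  proof (cases "x \<le> s")
    case True
    moreover have "0 \<le> s * \<Phi> x" using \<open>0 < s\<close> young_function_nonneg[OF Y that] by simp
    ultimately show ?thesis by (simp add: distrib_left)
  next
    case False
    have "\<Phi> ((s / x) * x) \<le> (s / x) * \<Phi> x"
      using False that \<open>0 < s\<close> by (intro young_function_scale[OF Y]) auto
    then have "x \<le> s * \<Phi> x" using False s \<open>0 < s\<close> by (simp add: field_simps)
    then show ?thesis using \<open>0 < s\<close> by (simp add: distrib_left)
  qed
  have ext_bound: "t \<le> ennreal s * (1 + young_ext \<Phi> t)" for t
  proof (cases t)
    case (real x)
    then show ?thesis
      using real_bound[of x] young_function_nonneg[OF Y, of x] \<open>0 < s\<close>
      by (simp add: young_ext_def ennreal_mult[symmetric] flip: ennreal_1 ennreal_plus)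
  next
    case top
    then show ?thesis using \<open>0 < s\<close> by (simp add: young_ext_def ennreal_mult_top)
  qed
  show ?thesis
  proof (rule that[of "2 * s"])
    fix f :: "'a \<Rightarrow> ennreal" and E :: "'a set"
    assume [measurable]: "f \<in> borel_measurable lebesgue" "E \<in> sets lebesgue"
      and E: "emeasure lebesgue E < \<infinity>"
    note [measurable] = borel_measurable_young_ext[OF Y]
    have "avg f E \<le> ennreal (2 * s) * ennreal c"
      if c: "0 < c" "avg (\<lambda>x. young_ext \<Phi> (f x / ennreal c)) E \<le> 1" for c
    proof -
      have "f x \<le> ennreal (c * s) * (1 + young_ext \<Phi> (f x / ennreal c))" for x
      proof -
        have "f x = ennreal c * (f x / ennreal c)"
          using c mult_divide_eq_ennreal[of "ennreal c" "f x"]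
          by (simp add: ennreal_times_divide mult.commute)
        also have "\<dots> \<le> ennreal c * (ennreal s * (1 + young_ext \<Phi> (f x / ennreal c)))"
          by (intro mult_left_mono ext_bound) simp
        finally show ?thesis using c \<open>0 < s\<close> by (simp add: ennreal_mult mult.assoc)
      qed
      then have "avg f E \<le> avg (\<lambda>x. ennreal (c * s) * (1 + young_ext \<Phi> (f x / ennreal c))) E"
        by (intro avg_mono)
      also have "\<dots> = ennreal (c * s) * (emeasure lebesgue E / emeasure lebesgue E
          + avg (\<lambda>x. young_ext \<Phi> (f x / ennreal c)) E)"
      proof -
        have "(\<integral>\<^sup>+x\<in>E. ennreal (c * s) * (1 + young_ext \<Phi> (f x / ennreal c)) \<partial>lebesgue)
          = (\<integral>\<^sup>+x. ennreal (c * s) * (indicator E x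
              + young_ext \<Phi> (f x / ennreal c) * indicator E x) \<partial>lebesgue)"
          by (intro nn_integral_cong) (auto simp: indicator_def)
        also have "\<dots> = ennreal (c * s) * (emeasure lebesgue E
            + (\<integral>\<^sup>+x\<in>E. young_ext \<Phi> (f x / ennreal c) \<partial>lebesgue))"
          by (simp add: nn_integral_cmult nn_integral_add)
        finally show ?thesis
          by (simp add: avg_def ennreal_times_divide[symmetric] add_divide_distrib_ennreal)
      qed
      also have "\<dots> \<le> ennreal (c * s) * (1 + 1)"
      proof -
        \<comment> \<open>For a null set the quotient \<open>0 / 0\<close> is \<open>0\<close>,
          hence only an inequality. Two terms of size at most 1 account for the constant
          \<open>2 * s\<close>.\<close>
        have "emeasure lebesgue E / emeasure lebesgue E \<le> 1"
          using E by (cases "emeasure lebesgue E = 0") (auto simp: ennreal_divide_self)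
        then show ?thesis using c by (intro mult_left_mono add_mono) auto
      qed
      also have "\<dots> = ennreal (2 * s) * ennreal c"
        using c \<open>0 < s\<close> by (simp add: ennreal_mult mult_ac)
      finally show ?thesis .
    qed
    then show "avg f E \<le> ennreal (2 * s) * orlicz_norm \<Phi> f E"
      unfolding orlicz_norm_def using \<open>0 < s\<close> by (intro ennreal_mult_Inf_le) auto
  qed (use \<open>0 < s\<close> in simp)
qed

subsection \<open>Greedy selection and distribution functions\<close>

lemma ennreal_inverse_le_iff:
  fixes x y :: ennreal
  shows "inverse x \<le> inverse y \<longleftrightarrow> y \<le> x"
proof (cases "x = 0 \<or> y = 0 \<or> x = top \<or> y = top")
  case True
  then show ?thesis by (auto simp: top_unique)
next
  case False
  then obtain r s where "x = ennreal r" "y = ennreal s" "0 < r" "0 < s"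
    by (metis ennreal_cases ennreal_0 order_le_less)
  then show ?thesis by (simp add: inverse_ennreal)
qed

text \<open>Sets are inserted by increasing \<open>inverse (l B)\<close>, that is, by decreasing
  \<open>l\<close>. A new set is either covered beyond the fraction \<open>\<gamma>\<close> already,
  or its uncovered part keeps at least \<open>1 - \<gamma>\<close> of its measure and becomes
  \<open>E B\<close>. Later selections never shrink the union that covers an earlier set.\<close>

lemma greedy_selection:
  fixes l :: "'a set \<Rightarrow> ennreal"
  assumes "finite F" and \<gamma>: "0 < \<gamma>" "\<gamma> < 1"
    and F: "F \<subseteq> sets M" "\<forall>B\<in>F. emeasure M B \<noteq> 0 \<and> emeasure M B < \<infinity>"
  shows "\<exists>S E. S \<subseteq> F \<and> disjoint_family_on E S \<and>
    (\<forall>B\<in>S. E B \<in> sets M \<and> E B \<subseteq> B \<and> ennreal (1 - \<gamma>) * emeasure M B \<le> emeasure M (E B)) \<and>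
    (\<forall>B\<in>F. ennreal \<gamma> * emeasure M B < emeasure M (B \<inter> \<Union>{B'\<in>S. l B \<le> l B'}))"
  using assms(1) F
proof (induction F rule: finite_ranking_induct[where f = "\<lambda>B. inverse (l B)"])
  case empty
  then show ?case by (intro exI[of _ "{}"]) (auto simp: disjoint_family_on_def)
next
  case (insert B F)
  show ?case
  proof (cases "B \<in> F")
    case True
    then show ?thesis using insert.IH insert.prems by (simp add: insert_absorb)
  next
    case False
    have min: "l B \<le> l B'" if "B' \<in> F" for B'
      using insert.hyps(2)[OF that] by (simp add: ennreal_inverse_le_iff)
    obtain S E where SF: "S \<subseteq> F" and dis: "disjoint_family_on E S"
      and E: "\<forall>B\<in>S. E B \<in> sets M \<and> E B \<subseteq> B \<and> ennreal (1 - \<gamma>) * emeasure M B \<le> emeasure M (E B)"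
      and cov: "\<forall>B\<in>F. ennreal \<gamma> * emeasure M B < emeasure M (B \<inter> \<Union>{B'\<in>S. l B \<le> l B'})"
      using insert.IH insert.prems by (auto 0 3)
    have "finite S" using SF insert.hyps(1) by (rule finite_subset)
    have B[measurable]: "B \<in> sets M" and posB: "emeasure M B \<noteq> 0" and finB: "emeasure M B < \<infinity>"
      using insert.prems by auto
    have G[measurable]: "\<Union>S \<in> sets M"
      using SF insert.prems \<open>finite S\<close> by (intro sets.finite_Union) auto
    show ?thesis
    proof (cases "ennreal \<gamma> * emeasure M B < emeasure M (B \<inter> \<Union>S)")
      case True
      \<comment> \<open>\<open>B\<close> has the least level so far, so the restriction on levels
        discards no selected set.\<close>
      moreover have "{B' \<in> S. l B \<le> l B'} = S" using min SF by auto
      ultimately show ?thesis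
        using SF dis E cov by (intro exI[of _ S] exI[of _ E]) auto
    next
      case notcov: False
      define E' where "E' = E(B := B - \<Union>S)"
      have E'S: "E' B' = E B'" if "B' \<in> S" for B' using that SF False by (auto simp: E'_def)
      have "ennreal (1 - \<gamma>) * emeasure M B \<le> emeasure M (B - \<Union>S)"
      proof -
        have "ennreal (1 - \<gamma>) * emeasure M B + ennreal \<gamma> * emeasure M B = emeasure M B"
          using \<gamma> by (simp flip: distrib_right ennreal_plus)
        also have "\<dots> = emeasure M (B - \<Union>S) + emeasure M (B \<inter> \<Union>S)"
          by (subst plus_emeasure) (auto intro!: arg_cong[where f="emeasure M"])
        also have "\<dots> \<le> emeasure M (B - \<Union>S) + ennreal \<gamma> * emeasure M B"
          using notcov by (intro add_left_mono) simp
        finally have "ennreal \<gamma> * emeasure M B + ennreal (1 - \<gamma>) * emeasure M B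
            \<le> ennreal \<gamma> * emeasure M B + emeasure M (B - \<Union>S)"
          by (simp only: add.commute)
        moreover have "ennreal \<gamma> * emeasure M B \<noteq> \<infinity>"
          using finB by (simp add: ennreal_mult_eq_top_iff)
        ultimately show ?thesis by (simp only: ennreal_add_left_cancel_le) simp
      qed
      moreover have "disjoint_family_on E' (insert B S)"
      proof -
        have "B \<notin> S" using SF False by auto
        moreover have "disjoint_family_on E' S"
          using dis by (simp add: disjoint_family_on_def E'S)
        moreover have "E' B \<inter> \<Union> (E' ` S) = {}"
          using E by (simp add: E'S) (fastforce simp: E'_def)
        ultimately show ?thesis by (simp add: disjoint_family_on_insert)
      qed
      moreover have "ennreal \<gamma> * emeasure M B' < emeasure M (B' \<inter> \<Union>{B''\<in>insert B S. l B' \<le> l B''})"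
        if "B' \<in> insert B F" for B'
      proof (cases "B' = B")
        case True
        \<comment> \<open>A selected set covers itself entirely; as its measure is positive and
          finite, \<open>\<gamma> < 1\<close> makes the inequality strict.\<close>
        have "ennreal \<gamma> * emeasure M B < ennreal 1 * emeasure M B"
          using \<gamma> posB finB by (intro ennreal_mult_strict_right_mono) (auto simp: ennreal_less_iff zero_less_iff_neq_zero)
        moreover have "B \<inter> \<Union>{B''\<in>insert B S. l B \<le> l B''} = B" by auto
        ultimately show ?thesis using True by (metis ennreal_1 mult_1)
      next
        case False
        then have "B' \<in> F" using that by simp
        then have "ennreal \<gamma> * emeasure M B' < emeasure M (B' \<inter> \<Union>{B''\<in>S. l B' \<le> l B''})"
          using cov by blast
        also have "\<dots> \<le> emeasure M (B' \<inter> \<Union>{B''\<in>insert B S. l B' \<le> l B''})"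
        proof (rule emeasure_mono)
          have "insert B S \<subseteq> sets M" using insert.prems(1) SF by blast
          moreover have "finite {B''\<in>insert B S. l B' \<le> l B''}" using \<open>finite S\<close> by simp
          ultimately have "\<Union>{B''\<in>insert B S. l B' \<le> l B''} \<in> sets M"
            by (intro sets.finite_Union) blast+
          then show "B' \<inter> \<Union>{B''\<in>insert B S. l B' \<le> l B''} \<in> sets M"
            using insert.prems(1) \<open>B' \<in> F\<close> by (intro sets.Int) blast+
        qed blast
        finally show ?thesis .
      qed
      moreover have "E' B' \<in> sets M \<and> E' B' \<subseteq> B' \<and>
          ennreal (1 - \<gamma>) * emeasure M B' \<le> emeasure M (E' B')" if "B' \<in> insert B S" for B'
      proof (cases "B' = B")
        case True
        then show ?thesis using calculation(1) by (auto simp: E'_def)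
      next
        case False
        then show ?thesis using that E E'S[of B'] by simp
      qed
      moreover have "insert B S \<subseteq> insert B F" using SF by blast
      ultimately show ?thesis by (intro exI[of _ "insert B S"] exI[of _ E'] conjI ballI) blast+
    qed
  qed
qed

section \<open>Layer-cake formula and comparison of distribution functions\<close>

lemma sigma_finite_lebesgue: "sigma_finite_measure (lebesgue :: 'a::euclidean_space measure)"
proof
  obtain A :: "'a set set" where "countable A" "A \<subseteq> sets lborel" "\<Union>A = space lborel"
    "\<forall>a\<in>A. emeasure lborel a \<noteq> \<infinity>"
    using lborel.sigma_finite_countable by blast
  then show "\<exists>A::'a set set. countable A \<and> A \<subseteq> sets lebesgue \<and> \<Union>A = space lebesgue \<and>
      (\<forall>a\<in>A. emeasure lebesgue a \<noteq> \<infinity>)"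
    by (intro exI[of _ A]) (auto simp: subset_eq)
qed

text \<open>The set is the interval from \<open>0\<close> up to \<open>y\<close>; for infinite
  \<open>y\<close> it is a half-line, which contains \<open>{0..n}\<close> for every
  \<open>n\<close>. This writes a value as the length of the set of levels below it.\<close>

lemma emeasure_lborel_Collect_less: "emeasure lborel {t. 0 \<le> t \<and> ennreal t < y} = y"
proof (cases y)
  case (real r)
  then have "{t. 0 \<le> t \<and> ennreal t < y} = {0..<r}" by (auto simp: ennreal_less_iff)
  then show ?thesis using real by simp
next
  case top
  have "emeasure lborel {0::real..} = top"
  proof (rule ccontr)
    assume "emeasure lborel {0::real..} \<noteq> top"
    then obtain n where "emeasure lborel {0::real..} < of_nat n"
      using ennreal_Ex_less_of_nat less_top by blast
    moreover have "of_nat n \<le> emeasure lborel {0::real..}"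
      using emeasure_mono[of "{0..real n}" "{0..}" lborel] by (simp add: ennreal_of_nat_eq_real_of_nat)
    ultimately show False by simp
  qed
  then show ?thesis using top by (simp add: atLeast_def)
qed

text \<open>Each \<open>f x\<close> is the length of the set of levels \<open>t\<close> with
  \<open>0 \<le> t < f x\<close>; Fubini's theorem, for which sigma-finiteness is assumed, then
  exchanges the integrals over points and levels.\<close>

lemma nn_integral_layer_cake:
  assumes "sigma_finite_measure M"
    and [measurable]: "f \<in> borel_measurable M" "u \<in> borel_measurable M"
  shows "(\<integral>\<^sup>+x. f x * u x \<partial>M) =
    (\<integral>\<^sup>+t\<in>{0..}. (\<integral>\<^sup>+x. u x * indicator {x. ennreal t < f x} x \<partial>M) \<partial>lborel)"
proof -
  interpret sigma_finite_measure M by fact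
  interpret pair_sigma_finite M "lborel :: real measure" ..
  have "(\<integral>\<^sup>+x. f x * u x \<partial>M) =
      (\<integral>\<^sup>+x. (\<integral>\<^sup>+t. u x * indicator {t. 0 \<le> t \<and> ennreal t < f x} t \<partial>lborel) \<partial>M)"
    by (subst nn_integral_cmult_indicator) (auto simp: emeasure_lborel_Collect_less mult.commute)
  also have "\<dots> = (\<integral>\<^sup>+x. (\<integral>\<^sup>+t. (u x * indicator {x. ennreal t < f x} x) * indicator {0..} t \<partial>lborel) \<partial>M)"
    by (intro nn_integral_cong) (auto simp: indicator_def)
  also have "\<dots> = (\<integral>\<^sup>+t. (\<integral>\<^sup>+x. (u x * indicator {x. ennreal t < f x} x) * indicator {0..} t \<partial>M) \<partial>lborel)"
    by (rule Fubini'[symmetric]) measurable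
  also have "\<dots> = (\<integral>\<^sup>+t\<in>{0..}. (\<integral>\<^sup>+x. u x * indicator {x. ennreal t < f x} x \<partial>M) \<partial>lborel)"
    by (subst nn_integral_multc) (auto)
  finally show ?thesis .
qed

lemma nn_integral_le_of_distribution:
  assumes "sigma_finite_measure M"
    and [measurable]: "f \<in> borel_measurable M" "h \<in> borel_measurable M" "u \<in> borel_measurable M"
    and le: "\<And>t. 0 \<le> t \<Longrightarrow> (\<integral>\<^sup>+x. u x * indicator {x. ennreal t < f x} x \<partial>M)
      \<le> c * (\<integral>\<^sup>+x. u x * indicator {x. ennreal t < h x} x \<partial>M)"
  shows "(\<integral>\<^sup>+x. f x * u x \<partial>M) \<le> c * (\<integral>\<^sup>+x. h x * u x \<partial>M)"
proof -
  interpret sigma_finite_measure M by fact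
  interpret pair_sigma_finite M "lborel :: real measure" ..
  have [measurable]: "(\<lambda>t. \<integral>\<^sup>+x. u x * indicator {x. ennreal t < h x} x \<partial>M) \<in> borel_measurable borel"
    by measurable
  have "(\<integral>\<^sup>+x. f x * u x \<partial>M)
    \<le> (\<integral>\<^sup>+t. c * ((\<integral>\<^sup>+x. u x * indicator {x. ennreal t < h x} x \<partial>M) * indicator {0..} t) \<partial>lborel)"
    unfolding nn_integral_layer_cake[OF assms(1,2,4)]
  proof (intro nn_integral_mono)
    show "(\<integral>\<^sup>+x. u x * indicator {x. ennreal t < f x} x \<partial>M) * indicator {0..} t
      \<le> c * ((\<integral>\<^sup>+x. u x * indicator {x. ennreal t < h x} x \<partial>M) * indicator {0..} t)" for t
      using le[of t] by (cases "0 \<le> t") auto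
  qed
  also have "\<dots> = c * (\<integral>\<^sup>+x. h x * u x \<partial>M)"
    unfolding nn_integral_layer_cake[OF assms(1,3,4)] by (intro nn_integral_cmult) measurable
  finally show ?thesis .
qed

section \<open>Suprema over families of open sets\<close>

lemma SUP_mem_eq_SUP_indicator:
  fixes l :: "'a set \<Rightarrow> ennreal"
  shows "(SUP B\<in>{B\<in>\<B>. x \<in> B}. l B) = (SUP B\<in>\<B>. l B * indicator B x)"
proof (rule antisym)
  show "(SUP B\<in>{B\<in>\<B>. x \<in> B}. l B) \<le> (SUP B\<in>\<B>. l B * indicator B x)"
    by (rule SUP_mono) force
  show "(SUP B\<in>\<B>. l B * indicator B x) \<le> (SUP B\<in>{B\<in>\<B>. x \<in> B}. l B)"
    by (rule SUP_least) (auto split: split_indicator intro: SUP_upper)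
qed

text \<open>For each rational \<open>r\<close>, Lindeloef's property gives countably many of the
  sets with \<open>l B > r\<close> that cover the same points. A value strictly below the supremum
  at \<open>x\<close> is separated by some rational from \<open>l B\<close> for a set
  \<open>B\<close> containing \<open>x\<close>, so one of the countably many sets for that rational
  exceeds it too.\<close>

lemma countable_SUP_indicator:
  fixes l :: "'a::second_countable_topology set \<Rightarrow> ennreal"
  assumes "\<And>B. B \<in> \<B> \<Longrightarrow> open B"
  obtains \<B>' where "countable \<B>'" "\<B>' \<subseteq> \<B>"
    "\<And>x. (SUP B\<in>\<B>. l B * indicator B x) = (SUP B\<in>\<B>'. l B * indicator B x)"
proof -
  have "\<exists>\<D>\<subseteq>{B\<in>\<B>. ennreal r < l B}. countable \<D> \<and> \<Union>\<D> = \<Union>{B\<in>\<B>. ennreal r < l B}" for r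
  proof -
    obtain \<D> where "\<D> \<subseteq> {B\<in>\<B>. ennreal r < l B}" "countable \<D>" "\<Union>\<D> = \<Union>{B\<in>\<B>. ennreal r < l B}"
      using Lindelof[of "{B\<in>\<B>. ennreal r < l B}"] assms by blast
    then show ?thesis by blast
  qed
  then obtain \<D> where \<D>: "\<And>r. \<D> r \<subseteq> {B\<in>\<B>. ennreal r < l B}" "\<And>r. countable (\<D> r)"
      "\<And>r. \<Union>(\<D> r) = \<Union>{B\<in>\<B>. ennreal r < l B}"
    by metis
  define \<B>' where "\<B>' = (\<Union>r\<in>\<rat>. \<D> r)"
  show ?thesis
  proof (rule that[of \<B>'])
    show "countable \<B>'" unfolding \<B>'_def by (intro countable_UN countable_rat \<D>)
    show sub: "\<B>' \<subseteq> \<B>" using \<D>(1) by (auto simp: \<B>'_def)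
    show "(SUP B\<in>\<B>. l B * indicator B x) = (SUP B\<in>\<B>'. l B * indicator B x)" for x
    proof (rule antisym)
      show "(SUP B\<in>\<B>. l B * indicator B x) \<le> (SUP B\<in>\<B>'. l B * indicator B x)"
      proof (rule dense_le)
        fix y assume "y < (SUP B\<in>\<B>. l B * indicator B x)"
        then obtain B where B: "B \<in> \<B>" "y < l B * indicator B x" by (auto simp: less_SUP_iff)
        then have "x \<in> B" "y < l B" by (auto split: split_indicator_asm)
        then obtain r :: real where r: "r \<in> \<rat>" "y < ennreal r" "ennreal r < l B"
          using ennreal_rat_dense by (metis Rats_of_rat)
        then have "x \<in> \<Union>(\<D> r)" using \<D>(3) B \<open>x \<in> B\<close> by blast
        then obtain B' where "B' \<in> \<D> r" "x \<in> B'" by blast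
        then have "B' \<in> \<B>'" "y \<le> l B' * indicator B' x"
          using \<D>(1)[of r] r by (auto simp: \<B>'_def)
        then show "y \<le> (SUP B\<in>\<B>'. l B * indicator B x)" by (rule SUP_upper2)
      qed
    qed (rule SUP_subset_mono[OF sub order_refl])
  qed
qed

text \<open>The family may be uncountable; openness of its members reduces the supremum to a
  countable one.\<close>

lemma borel_measurable_SUP_indicator_open:
  fixes l :: "'a::euclidean_space set \<Rightarrow> ennreal"
  assumes "\<And>B. B \<in> \<B> \<Longrightarrow> open B"
  shows "(\<lambda>x. SUP B\<in>\<B>. l B * indicator B x) \<in> borel_measurable lebesgue"
proof -
  obtain \<B>' where "countable \<B>'" "\<B>' \<subseteq> \<B>"
    "\<And>x. (SUP B\<in>\<B>. l B * indicator B x) = (SUP B\<in>\<B>'. l B * indicator B x)"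
    using countable_SUP_indicator[OF assms] by blast
  then have "(\<lambda>x. SUP B\<in>\<B>. l B * indicator B x) \<in> borel_measurable lborel"
    using assms by (auto intro!: borel_measurable_SUP borel_measurable_times_ennreal borel_measurable_indicator)
  then show ?thesis by (rule measurable_completion)
qed

lemma nn_integral_SUP_indicator_open_le:
  fixes l :: "'a::euclidean_space set \<Rightarrow> ennreal"
  assumes op: "\<And>B. B \<in> \<B> \<Longrightarrow> open B" and [measurable]: "u \<in> borel_measurable lebesgue"
    and le: "\<And>F. finite F \<Longrightarrow> F \<subseteq> \<B> \<Longrightarrow>
      (\<integral>\<^sup>+x. (SUP B\<in>F. l B * indicator B x) * u x \<partial>lebesgue) \<le> c"
  shows "(\<integral>\<^sup>+x. (SUP B\<in>\<B>. l B * indicator B x) * u x \<partial>lebesgue) \<le> c"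
proof -
  obtain \<B>' where \<B>': "countable \<B>'" "\<B>' \<subseteq> \<B>"
    and eq: "\<And>x. (SUP B\<in>\<B>. l B * indicator B x) = (SUP B\<in>\<B>'. l B * indicator B x)"
    using countable_SUP_indicator[OF op] by blast
  show ?thesis
  proof (cases "\<B>' = {}")
    case True
    then show ?thesis by (simp add: eq bot_ennreal)
  next
    case False
    \<comment> \<open>Initial segments of an enumeration: finite, increasing and exhausting
      \<open>\<B>'\<close>, as monotone convergence requires.\<close>
    define F where "F n = from_nat_into \<B>' ` {..<n}" for n
    have F: "finite (F n)" "F n \<subseteq> \<B>" for n
      using \<B>'(2) from_nat_into[OF False] by (auto simp: F_def)
    have UF: "(\<Union>n. F n) = \<B>'"
      using range_from_nat_into[OF False \<B>'(1)]
      by (simp only: F_def image_UN[symmetric] UN_lessThan_UNIV)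
    have "(SUP B\<in>\<B>. l B * indicator B x) = (SUP n. SUP B\<in>F n. l B * indicator B x)" for x
      unfolding eq UF[symmetric] by (simp add: SUP_UNION)
    then have "(\<integral>\<^sup>+x. (SUP B\<in>\<B>. l B * indicator B x) * u x \<partial>lebesgue)
      = (\<integral>\<^sup>+x. (SUP n. (SUP B\<in>F n. l B * indicator B x) * u x) \<partial>lebesgue)"
      by (simp add: SUP_mult_right_ennreal)
    also have "\<dots> = (SUP n. \<integral>\<^sup>+x. (SUP B\<in>F n. l B * indicator B x) * u x \<partial>lebesgue)"
    proof (rule nn_integral_monotone_convergence_SUP)
      show "incseq (\<lambda>n x. (SUP B\<in>F n. l B * indicator B x) * u x)"
        by (intro monoI le_funI mult_right_mono SUP_subset_mono) (auto simp: F_def)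
      show "(\<lambda>x. (SUP B\<in>F n. l B * indicator B x) * u x) \<in> borel_measurable lebesgue" for n
        using F op by (intro borel_measurable_times_ennreal borel_measurable_SUP_indicator_open) auto
    qed
    also have "\<dots> \<le> c" by (intro SUP_least le F)
    finally show ?thesis .
  qed
qed

section \<open>Selection under the Tauberian condition\<close>

lemma basisD:
  assumes "basis \<B>" "B \<in> \<B>"
  shows "open B" "B \<in> sets lebesgue" "emeasure lebesgue B < \<infinity>"
  using assms unfolding basis_def by (auto simp del: emeasure_completion)

text \<open>\<open>B\<close> itself competes in the supremum at \<open>x\<close>, and the average of
  the indicator over \<open>B\<close> is the fraction of \<open>B\<close> occupied by
  \<open>G\<close>.\<close>

lemma maximal_op_indicator:
  assumes "basis \<B>" "B \<in> \<B>" "x \<in> B" "G \<in> sets lebesgue"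
    and "ennreal \<gamma> * emeasure lebesgue B < emeasure lebesgue (B \<inter> G)"
  shows "ennreal \<gamma> < maximal_op \<B> (indicator G) x"
proof -
  note B = basisD[OF assms(1,2)]
  have "(\<integral>\<^sup>+y\<in>B. ennreal \<bar>indicator G y\<bar> \<partial>lebesgue) = (\<integral>\<^sup>+y. indicator (B \<inter> G) y \<partial>lebesgue)"
    by (intro nn_integral_cong) (auto split: split_indicator)
  also have "\<dots> = emeasure lebesgue (B \<inter> G)"
    using B assms(4) by (intro nn_integral_indicator) auto
  finally have avg: "avg (\<lambda>y. ennreal \<bar>indicator G y\<bar>) B = emeasure lebesgue (B \<inter> G) / emeasure lebesgue B"
    by (simp only: avg_def)
  have "emeasure lebesgue (B \<inter> G) \<le> emeasure lebesgue B"
    using B assms(4) by (intro emeasure_mono) auto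
  \<comment> \<open>If \<open>B\<close> were null, both sides of the strict hypothesis would be
    zero.\<close>
  then have ne: "emeasure lebesgue B \<noteq> 0" using assms(5) by (metis le_zero_eq not_less_zero)
  have "ennreal \<gamma> < emeasure lebesgue (B \<inter> G) / emeasure lebesgue B"
  proof (rule ccontr)
    assume "\<not> ?thesis"
    then have "emeasure lebesgue (B \<inter> G) / emeasure lebesgue B * emeasure lebesgue B
      \<le> ennreal \<gamma> * emeasure lebesgue B"
      by (intro mult_right_mono) auto
    moreover have "emeasure lebesgue (B \<inter> G) / emeasure lebesgue B * emeasure lebesgue B
      = emeasure lebesgue (B \<inter> G)"
      using ne B(3) by (subst ennreal_divide_times) (auto simp: ennreal_divide_self simp del: emeasure_completion)
    ultimately show False using assms(5) by simp
  qed
  also have "\<dots> \<le> maximal_op \<B> (indicator G) x"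
    unfolding maximal_op_def avg[symmetric] using assms by (intro SUP_upper) auto
  finally show ?thesis .
qed

lemma emeasure_lebesgue_open_neq_0:
  fixes B :: "'a::euclidean_space set"
  assumes "open B" "B \<noteq> {}"
  shows "emeasure lebesgue B \<noteq> 0"
proof
  assume "emeasure lebesgue B = 0"
  then have "emeasure lborel B = 0" using assms by simp
  obtain x e where "0 < e" "ball x e \<subseteq> B" using assms openE by blast
  then have "emeasure lborel (ball x e) \<le> emeasure lborel B"
    using assms by (intro emeasure_mono) auto
  then have "measure lborel (ball x e) = 0"
    using \<open>emeasure lborel B = 0\<close> by (simp add: measure_def)
  then show False using content_ball_pos[OF \<open>0 < e\<close>, of x] by simp
qed

text \<open>A set of \<open>F\<close> with \<open>l B > t\<close> is covered beyond the fraction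
  \<open>\<gamma>\<close> by selected sets of level at least \<open>l B\<close>, hence of level
  above \<open>t\<close>. One selection therefore serves all levels \<open>t\<close> at
  once.\<close>

lemma tauberian_selection:
  fixes l :: "'a::euclidean_space set \<Rightarrow> ennreal"
  assumes bas: "basis \<B>" and \<gamma>: "0 < \<gamma>" "\<gamma> < 1"
    and [measurable]: "u \<in> borel_measurable lebesgue"
    and taub: "\<And>E. E \<in> sets lebesgue \<Longrightarrow>
      (\<integral>\<^sup>+x\<in>{x. maximal_op \<B> (indicator E) x > ennreal \<gamma>}. u x \<partial>lebesgue)
        \<le> c * (\<integral>\<^sup>+x\<in>E. u x \<partial>lebesgue)"
    and F: "finite F" "F \<subseteq> \<B>" "{} \<notin> F"
  obtains S E where "S \<subseteq> F" "disjoint_family_on E S"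
    "\<And>B. B \<in> S \<Longrightarrow> E B \<in> sets lebesgue" "\<And>B. B \<in> S \<Longrightarrow> E B \<subseteq> B"
    "\<And>B. B \<in> S \<Longrightarrow> ennreal (1 - \<gamma>) * emeasure lebesgue B \<le> emeasure lebesgue (E B)"
    "(\<integral>\<^sup>+x. (SUP B\<in>F. l B * indicator B x) * u x \<partial>lebesgue)
      \<le> c * (\<Sum>B\<in>S. l B * (\<integral>\<^sup>+x\<in>B. u x \<partial>lebesgue))"
proof -
  have opF: "open B" if "B \<in> F" for B using that F basisD(1)[OF bas] by blast
  have ne: "emeasure lebesgue B \<noteq> 0" if "B \<in> F" for B
    using that F(3) opF by (intro emeasure_lebesgue_open_neq_0) auto
  obtain S E where S: "S \<subseteq> F" "disjoint_family_on E S"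
    and E: "\<forall>B\<in>S. E B \<in> sets lebesgue \<and> E B \<subseteq> B \<and>
      ennreal (1 - \<gamma>) * emeasure lebesgue B \<le> emeasure lebesgue (E B)"
    and cov: "\<forall>B\<in>F. ennreal \<gamma> * emeasure lebesgue B
      < emeasure lebesgue (B \<inter> \<Union>{B'\<in>S. l B \<le> l B'})"
  proof -
    have "F \<subseteq> sets lebesgue" "\<forall>B\<in>F. emeasure lebesgue B \<noteq> 0 \<and> emeasure lebesgue B < \<infinity>"
      using F(2) basisD[OF bas] ne by blast+
    from greedy_selection[OF F(1) \<gamma> this, of l] show ?thesis
      by (elim exE conjE) (rule that)
  qed
  have finS: "finite S" using S(1) F(1) by (rule finite_subset)
  have opS: "open B" if "B \<in> S" for B using that S opF by blast
  have Smeas[measurable]: "B \<in> sets lebesgue" if "B \<in> S" for B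
    using opS[OF that] by (intro sets_completionI_sets) simp
  let ?f = "\<lambda>x. SUP B\<in>F. l B * indicator B x" and ?h = "\<lambda>x. SUP B\<in>S. l B * indicator B x"
  have meas: "?f \<in> borel_measurable lebesgue" "?h \<in> borel_measurable lebesgue"
    using opF opS by (auto intro: borel_measurable_SUP_indicator_open)
  have "(\<integral>\<^sup>+x. ?f x * u x \<partial>lebesgue) \<le> c * (\<integral>\<^sup>+x. ?h x * u x \<partial>lebesgue)"
  proof (rule nn_integral_le_of_distribution[OF sigma_finite_lebesgue meas])
    fix t :: real assume "0 \<le> t"
    let ?G = "\<Union>{B\<in>S. ennreal t < l B}"
    have G: "?G \<in> sets lebesgue"
    proof -
      have "open ?G" using opS by (intro open_Union) auto
      then show ?thesis by (intro sets_completionI_sets) simp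
    qed
    have less_iff: "ennreal t < l B * indicator B x \<longleftrightarrow> x \<in> B \<and> ennreal t < l B" for x B
      by (simp split: split_indicator)
    then have h_eq: "{x. ennreal t < ?h x} = ?G" by (auto simp: less_SUP_iff)
    have sub: "maximal_op \<B> (indicator ?G) x > ennreal \<gamma>" if fx: "ennreal t < ?f x" for x
    proof -
      obtain B where B: "B \<in> F" "x \<in> B" "ennreal t < l B"
        using fx unfolding less_SUP_iff less_iff by blast
      then have "B \<in> \<B>" using F(2) by blast
      have "ennreal \<gamma> * emeasure lebesgue B < emeasure lebesgue (B \<inter> \<Union>{B'\<in>S. l B \<le> l B'})"
        using cov B(1) by blast
      also have "\<dots> \<le> emeasure lebesgue (B \<inter> ?G)"
      proof (rule emeasure_mono)
        show "B \<inter> \<Union>{B'\<in>S. l B \<le> l B'} \<subseteq> B \<inter> ?G"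
          using B(3) order_less_le_trans by blast
        show "B \<inter> ?G \<in> sets lebesgue"
          by (intro sets.Int G basisD(2)[OF bas \<open>B \<in> \<B>\<close>])
      qed
      finally show ?thesis by (rule maximal_op_indicator[OF bas \<open>B \<in> \<B>\<close> B(2) G])
    qed
    have "(\<integral>\<^sup>+x. u x * indicator {x. ennreal t < ?f x} x \<partial>lebesgue)
      \<le> (\<integral>\<^sup>+x\<in>{x. maximal_op \<B> (indicator ?G) x > ennreal \<gamma>}. u x \<partial>lebesgue)"
      using sub by (intro nn_integral_mono mult_left_mono) (simp_all split: split_indicator)
    also have "\<dots> \<le> c * (\<integral>\<^sup>+x\<in>?G. u x \<partial>lebesgue)" by (rule taub[OF G])
    finally show "(\<integral>\<^sup>+x. u x * indicator {x. ennreal t < ?f x} x \<partial>lebesgue)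
      \<le> c * (\<integral>\<^sup>+x. u x * indicator {x. ennreal t < ?h x} x \<partial>lebesgue)"
      unfolding h_eq .
  qed simp
  also have "(\<integral>\<^sup>+x. ?h x * u x \<partial>lebesgue) \<le> (\<integral>\<^sup>+x. (\<Sum>B\<in>S. l B * (u x * indicator B x)) \<partial>lebesgue)"
  proof (rule nn_integral_mono)
    fix x
    \<comment> \<open>The selected sets may overlap, so the sum can count a point several times; the
      disjoint parts \<open>E B\<close> compensate for this later.\<close>
    have "?h x \<le> (\<Sum>B\<in>S. l B * indicator B x)"
      using finS by (intro SUP_least member_le_sum) auto
    then have "?h x * u x \<le> (\<Sum>B\<in>S. l B * indicator B x) * u x" by (rule mult_right_mono) simp
    then show "?h x * u x \<le> (\<Sum>B\<in>S. l B * (u x * indicator B x))"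
      by (simp add: sum_distrib_left sum_distrib_right mult_ac)
  qed
  also have "\<dots> = (\<Sum>B\<in>S. l B * (\<integral>\<^sup>+x\<in>B. u x \<partial>lebesgue))"
    by (subst nn_integral_sum) (auto intro!: sum.cong nn_integral_cmult)
  finally have "(\<integral>\<^sup>+x. ?f x * u x \<partial>lebesgue) \<le> c * (\<Sum>B\<in>S. l B * (\<integral>\<^sup>+x\<in>B. u x \<partial>lebesgue))"
    by (simp add: mult_left_mono)
  with S E show ?thesis by (intro that[of S E]) auto
qed

text \<open>For \<open>1 \<le> s\<close> a sum of powers is at most the power of the sum. In that
  sum \<open>B\<close> is replaced by \<open>E B\<close> at the cost
  \<open>1 / (1 - \<gamma>)\<close>, and disjointness puts the result below the integral of the
  supremum of \<open>d\<close>. In the application \<open>l\<close> and \<open>d\<close> are a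
  \<open>q\<close>-th and a \<open>p\<close>-th power, and \<open>s = q / p\<close>.\<close>

lemma tauberian_strong_type:
  fixes l d :: "'a::euclidean_space set \<Rightarrow> ennreal"
  assumes bas: "basis \<B>" and \<gamma>: "0 < \<gamma>" "\<gamma> < 1"
    and u[measurable]: "u \<in> borel_measurable lebesgue"
    and taub: "\<And>E. E \<in> sets lebesgue \<Longrightarrow>
      (\<integral>\<^sup>+x\<in>{x. maximal_op \<B> (indicator E) x > ennreal \<gamma>}. u x \<partial>lebesgue)
        \<le> c * (\<integral>\<^sup>+x\<in>E. u x \<partial>lebesgue)"
    and s: "1 \<le> s"
    and bound: "\<And>B. B \<in> \<B> \<Longrightarrow> B \<noteq> {} \<Longrightarrow>
      l B * (\<integral>\<^sup>+x\<in>B. u x \<partial>lebesgue) \<le> k * ennreal_pow (emeasure lebesgue B * d B) s"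
  shows "(\<integral>\<^sup>+x. (SUP B\<in>{B\<in>\<B>. x \<in> B}. l B) * u x \<partial>lebesgue)
    \<le> c * k * ennreal ((1 / (1 - \<gamma>)) powr s)
      * ennreal_pow (\<integral>\<^sup>+x. (SUP B\<in>{B\<in>\<B>. x \<in> B}. d B) \<partial>lebesgue) s"
    (is "_ \<le> ?K * ennreal_pow ?D s")
proof -
  have fin: "(\<integral>\<^sup>+x. (SUP B\<in>F. l B * indicator B x) * u x \<partial>lebesgue) \<le> ?K * ennreal_pow ?D s"
    if F: "finite F" "F \<subseteq> \<B> - {{}}" for F
  proof -
    obtain S E where S: "S \<subseteq> F" "disjoint_family_on E S"
      and E: "\<And>B. B \<in> S \<Longrightarrow> E B \<in> sets lebesgue" "\<And>B. B \<in> S \<Longrightarrow> E B \<subseteq> B"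
        "\<And>B. B \<in> S \<Longrightarrow> ennreal (1 - \<gamma>) * emeasure lebesgue B \<le> emeasure lebesgue (E B)"
      and le: "(\<integral>\<^sup>+x. (SUP B\<in>F. l B * indicator B x) * u x \<partial>lebesgue)
        \<le> c * (\<Sum>B\<in>S. l B * (\<integral>\<^sup>+x\<in>B. u x \<partial>lebesgue))"
      using F by (rule_tac tauberian_selection[OF bas \<gamma> u taub, of F l]) auto
    have finS: "finite S" using S(1) F(1) by (rule finite_subset)
    have size: "emeasure lebesgue B \<le> ennreal (1 / (1 - \<gamma>)) * emeasure lebesgue (E B)" if "B \<in> S" for B
    proof -
      have "emeasure lebesgue B = ennreal (1 / (1 - \<gamma>)) * (ennreal (1 - \<gamma>) * emeasure lebesgue B)"
        using \<gamma> by (simp flip: ennreal_mult mult.assoc)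
      also have "\<dots> \<le> ennreal (1 / (1 - \<gamma>)) * emeasure lebesgue (E B)"
        by (intro mult_left_mono E(3) that) simp
      finally show ?thesis .
    qed
    have sum_le: "(\<Sum>B\<in>S. emeasure lebesgue (E B) * d B) \<le> ?D"
    proof -
      have "(\<Sum>B\<in>S. emeasure lebesgue (E B) * d B) = (\<Sum>B\<in>S. \<integral>\<^sup>+x. d B * indicator (E B) x \<partial>lebesgue)"
        using E(1) by (intro sum.cong) (auto simp: nn_integral_cmult_indicator mult.commute)
      also have "\<dots> = (\<integral>\<^sup>+x. (\<Sum>B\<in>S. d B * indicator (E B) x) \<partial>lebesgue)"
        using E(1) by (intro nn_integral_sum[symmetric]) auto
      also have "\<dots> \<le> ?D"
      proof (rule nn_integral_mono)
        fix x
        show "(\<Sum>B\<in>S. d B * indicator (E B) x) \<le> (SUP B\<in>{B\<in>\<B>. x \<in> B}. d B)"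
        proof (cases "\<exists>B\<in>S. x \<in> E B")
          case True
          then obtain B where B: "B \<in> S" "x \<in> E B" by blast
          \<comment> \<open>Only one term of the sum survives at \<open>x\<close>, and
            \<open>E B \<subseteq> B\<close> makes its \<open>d B\<close> a competitor in the
            supremum.\<close>
          have "x \<notin> E B'" if "B' \<in> S - {B}" for B'
            using B that S(2) by (auto simp: disjoint_family_on_def)
          then have "(\<Sum>B'\<in>S. d B' * indicator (E B') x) = d B"
            using B finS by (subst sum.remove[of _ B]) auto
          also have "\<dots> \<le> (SUP B\<in>{B\<in>\<B>. x \<in> B}. d B)"
            using B E(2) S(1) F(2) by (intro SUP_upper) auto
          finally show ?thesis .
        qed simp
      qed
      finally show ?thesis .
    qed
    have "(\<Sum>B\<in>S. l B * (\<integral>\<^sup>+x\<in>B. u x \<partial>lebesgue))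
      \<le> (\<Sum>B\<in>S. k * ennreal_pow (emeasure lebesgue B * d B) s)"
      using S(1) F(2) by (intro sum_mono bound) auto
    also have "\<dots> \<le> k * ennreal_pow (\<Sum>B\<in>S. emeasure lebesgue B * d B) s"
      unfolding sum_distrib_left[symmetric] by (intro mult_left_mono sum_ennreal_pow_le s finS) simp
    also have "\<dots> \<le> k * ennreal_pow (ennreal (1 / (1 - \<gamma>)) * ?D) s"
    proof (intro mult_left_mono ennreal_pow_mono)
      have "(\<Sum>B\<in>S. emeasure lebesgue B * d B)
        \<le> (\<Sum>B\<in>S. ennreal (1 / (1 - \<gamma>)) * (emeasure lebesgue (E B) * d B))"
        unfolding mult.assoc[symmetric] by (intro sum_mono mult_right_mono size) auto
      also have "\<dots> \<le> ennreal (1 / (1 - \<gamma>)) * ?D"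
        unfolding sum_distrib_left[symmetric] by (intro mult_left_mono sum_le) simp
      finally show "(\<Sum>B\<in>S. emeasure lebesgue B * d B) \<le> ennreal (1 / (1 - \<gamma>)) * ?D" .
    qed (use s in auto)
    finally have "c * (\<Sum>B\<in>S. l B * (\<integral>\<^sup>+x\<in>B. u x \<partial>lebesgue))
      \<le> c * (k * ennreal_pow (ennreal (1 / (1 - \<gamma>)) * ?D) s)"
      by (rule mult_left_mono) simp
    also have "\<dots> = ?K * ennreal_pow ?D s"
      using \<gamma> by (simp add: ennreal_pow_mult mult.assoc)
    finally show ?thesis using le by (rule order_trans[rotated])
  qed
  have "{B\<in>\<B>. x \<in> B} = {B\<in>\<B> - {{}}. x \<in> B}" for x by auto
  then have "(\<integral>\<^sup>+x. (SUP B\<in>{B\<in>\<B>. x \<in> B}. l B) * u x \<partial>lebesgue)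
    = (\<integral>\<^sup>+x. (SUP B\<in>\<B> - {{}}. l B * indicator B x) * u x \<partial>lebesgue)"
    by (simp only: SUP_mem_eq_SUP_indicator)
  also have "\<dots> \<le> ?K * ennreal_pow ?D s"
    by (rule nn_integral_SUP_indicator_open_le[OF _ u fin]) (use basisD(1)[OF bas] in auto)
  finally show ?thesis .
qed

subsection \<open>The weighted bound\<close>

text \<open>The norm controls the average, so norm zero would make \<open>f\<close> vanish almost
  everywhere on \<open>E\<close>. It serves for reciprocals of weights, which are nowhere zero
  because weights are finite.\<close>

lemma orlicz_norm_neq_0:
  fixes E :: "'a::euclidean_space set"
  assumes Y: "young_function \<Phi>" and f[measurable]: "f \<in> borel_measurable lebesgue"
    and E[measurable]: "E \<in> sets lebesgue" and fin: "emeasure lebesgue E < \<infinity>"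
    and ne: "emeasure lebesgue E \<noteq> 0" and pos: "\<And>x. x \<in> E \<Longrightarrow> f x \<noteq> 0"
  shows "orlicz_norm \<Phi> f E \<noteq> 0"
proof
  assume "orlicz_norm \<Phi> f E = 0"
  obtain K where "avg f E \<le> ennreal K * orlicz_norm \<Phi> f E"
    using avg_le_orlicz_norm[OF Y, where ?'a = 'a] f E fin by metis
  then have "avg f E = 0" by (simp add: \<open>orlicz_norm \<Phi> f E = 0\<close>)
  then have "(\<integral>\<^sup>+x. f x * indicator E x \<partial>lebesgue) = 0"
    using fin by (auto simp: avg_def simp del: emeasure_completion)
  then have "AE x in lebesgue. f x * indicator E x = 0"
    by (subst (asm) nn_integral_0_iff_AE) measurable
  then have "AE x in lebesgue. x \<notin> E"
    by eventually_elim (use pos in \<open>auto split: split_indicator_asm\<close>)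
  then have "emeasure lebesgue E = 0"
    using AE_iff_measurable[OF E, of "\<lambda>x. x \<notin> E"] by simp
  with ne show False by contradiction
qed

lemma orlicz_norm_weighted_le:
  fixes S :: "'a::euclidean_space set"
  assumes Y: "young_function A" "young_function B" "young_function C"
    and inv: "\<And>t. t > 0 \<Longrightarrow>
      the_inv_into {0..} A t * the_inv_into {0..} C t \<le> the_inv_into {0..} B t"
    and [measurable]: "f \<in> borel_measurable lebesgue" "w \<in> borel_measurable lebesgue"
    and S: "S \<in> sets lebesgue" and w: "\<And>x. 0 \<le> w x"
    and A: "orlicz_norm A (\<lambda>x. inverse (ennreal (w x))) S \<noteq> 0"
      "orlicz_norm A (\<lambda>x. inverse (ennreal (w x))) S \<noteq> \<infinity>"
  shows "orlicz_norm B (\<lambda>x. ennreal \<bar>f x\<bar>) S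
    \<le> 2 * orlicz_norm A (\<lambda>x. inverse (ennreal (w x))) S * orlicz_norm C (\<lambda>x. ennreal \<bar>f x * w x\<bar>) S"
proof (rule orlicz_norm_holder[OF Y inv _ _ S _ A])
  fix x
  show "inverse (ennreal (w x)) = \<infinity> \<or> ennreal \<bar>f x * w x\<bar> = \<infinity> \<or>
    ennreal \<bar>f x\<bar> \<le> inverse (ennreal (w x)) * ennreal \<bar>f x * w x\<bar>"
    using w[of x] by (cases "w x = 0") (auto simp: inverse_ennreal abs_mult field_simps simp flip: ennreal_mult)
qed simp_all

text \<open>The \<open>q\<close>-th root of the integral of \<open>u\<close> over \<open>S\<close>
  is the product of \<open>ennreal_pow (avg u S) (1 / q)\<close> and the powers of the measure with
  exponents \<open>1 / q - 1 / p\<close> and \<open>1 / p\<close>. The first two factors complete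
  the weight condition bounded by \<open>K\<close>; the last joins the norms for \<open>C\<close>.
  Hoelder's inequality, once per component, costs \<open>2 ^ CARD('m)\<close>.\<close>

lemma orlicz_ball_estimate:
  fixes A B C :: "'m::finite \<Rightarrow> real \<Rightarrow> real" and S :: "'a::euclidean_space set"
    and w f :: "'m \<Rightarrow> 'a \<Rightarrow> real" and u :: "'a \<Rightarrow> ennreal" and a K :: ennreal
  assumes p: "0 < p" and q: "0 < q"
    and Y: "\<And>i. young_function (A i)" "\<And>i. young_function (B i)" "\<And>i. young_function (C i)"
    and inv: "\<And>i t. t > 0 \<Longrightarrow>
      the_inv_into {0..} (A i) t * the_inv_into {0..} (C i) t \<le> the_inv_into {0..} (B i) t"
    and f[measurable]: "\<And>i. f i \<in> borel_measurable lebesgue"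
    and w[measurable]: "\<And>i. w i \<in> borel_measurable lebesgue" and w0: "\<And>i x. 0 \<le> w i x"
    and S: "S \<in> sets lebesgue" "emeasure lebesgue S < \<infinity>" "emeasure lebesgue S \<noteq> 0"
    and a: "a \<noteq> 0" and K: "K < \<infinity>"
    and le: "a * ennreal (measure lebesgue S powr (1 / q - 1 / p)) * ennreal_pow (avg u S) (1 / q) *
      (\<Prod>i\<in>UNIV. orlicz_norm (A i) (\<lambda>x. inverse (ennreal (w i x))) S) \<le> K"
  shows "ennreal_pow (a * (\<Prod>i\<in>UNIV. orlicz_norm (B i) (\<lambda>x. ennreal \<bar>f i x\<bar>) S)) q
      * (\<integral>\<^sup>+x\<in>S. u x \<partial>lebesgue)
    \<le> ennreal_pow (2 ^ CARD('m) * K) q * ennreal_pow (emeasure lebesgue S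
      * ennreal_pow (\<Prod>i\<in>UNIV. orlicz_norm (C i) (\<lambda>x. ennreal \<bar>f i x * w i x\<bar>) S) p) (q / p)"
proof (cases "(\<integral>\<^sup>+x\<in>S. u x \<partial>lebesgue) = 0")
  case False
  define U where "U = (\<integral>\<^sup>+x\<in>S. u x \<partial>lebesgue)"
  define W where "W i = orlicz_norm (A i) (\<lambda>x. inverse (ennreal (w i x))) S" for i
  define N where "N i = orlicz_norm (B i) (\<lambda>x. ennreal \<bar>f i x\<bar>) S" for i
  define D where "D i = orlicz_norm (C i) (\<lambda>x. ennreal \<bar>f i x * w i x\<bar>) S" for i
  define m where "m = measure lebesgue S"
  define g where "g = ennreal_pow (avg u S) (1 / q)"
  define b where "b = ennreal (m powr (1 / q - 1 / p))"
  define r where "r = ennreal (m powr (1 / p))"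
  have m: "emeasure lebesgue S = ennreal m" "0 < m"
    using S(2,3) unfolding m_def
    by (auto simp: measure_def enn2real_positive_iff zero_less_iff_neq_zero simp del: emeasure_completion)
  have avg: "avg u S = U / ennreal m" by (simp add: avg_def U_def m)
  have "U \<noteq> 0" using False by (simp add: U_def)
  have U_eq: "U = ennreal_pow (g * (b * r)) q"
  proof -
    have "b * r = ennreal (m powr (1 / q))"
      using m by (simp add: b_def r_def flip: ennreal_mult powr_add)
    then have "ennreal_pow (g * (b * r)) q = (U / ennreal m) * ennreal m"
      using m q by (simp add: ennreal_pow_mult g_def avg ennreal_pow_pow powr_powr)
    also have "\<dots> = U" using m by (simp add: ennreal_divide_times)
    finally show ?thesis by simp
  qed
  have "W i \<noteq> 0" for i
    unfolding W_def using S w0 by (intro orlicz_norm_neq_0[OF Y(1)]) auto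
  \<comment> \<open>As the integral of \<open>u\<close> is not zero, the factors in front of the
    product are nonzero, so an infinite product would contradict \<open>K < \<infinity>\<close>.
    Since no \<open>W i\<close> is zero, each of them is then finite, as Hoelder's inequality
    requires.\<close>
  have "prod W UNIV \<noteq> top"
  proof
    assume "prod W UNIV = top"
    moreover have "a * b * g \<noteq> 0"
      using a m \<open>U \<noteq> 0\<close> by (simp add: b_def g_def avg)
    ultimately have "a * b * g * prod W UNIV = top" by simp
    then show False using le K by (simp add: W_def b_def g_def m_def top_unique)
  qed
  then have "W i \<noteq> top" for i
    using \<open>\<And>i. W i \<noteq> 0\<close> by (auto simp: ennreal_prod_eq_top)
  then have "N i \<le> 2 * W i * D i" for i
    unfolding N_def W_def D_def using \<open>\<And>i. W i \<noteq> 0\<close> S w0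
    by (intro orlicz_norm_weighted_le[OF Y inv f w]) (auto simp: W_def)
  then have "prod N UNIV \<le> (\<Prod>i\<in>UNIV. 2 * W i * D i)"
    by (intro prod_mono_ennreal) auto
  also have "\<dots> = 2 ^ CARD('m) * prod W UNIV * prod D UNIV"
    by (simp add: prod.distrib)
  finally have "a * prod N UNIV * (g * (b * r))
    \<le> a * (2 ^ CARD('m) * prod W UNIV * prod D UNIV) * (g * (b * r))"
    by (intro mult_right_mono mult_left_mono) auto
  also have "\<dots> = 2 ^ CARD('m) * (a * b * g * prod W UNIV) * (r * prod D UNIV)"
    by (simp add: mult_ac)
  also have "\<dots> \<le> 2 ^ CARD('m) * K * (r * prod D UNIV)"
    using le by (intro mult_right_mono mult_left_mono) (auto simp: W_def b_def g_def m_def)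
  finally have "ennreal_pow (a * prod N UNIV * (g * (b * r))) q
    \<le> ennreal_pow (2 ^ CARD('m) * K * (r * prod D UNIV)) q"
    using q by (intro ennreal_pow_mono) auto
  moreover have "ennreal_pow (a * prod N UNIV * (g * (b * r))) q = ennreal_pow (a * prod N UNIV) q * U"
    using U_eq by (simp add: ennreal_pow_mult[of "a * prod N UNIV"])
  moreover have "ennreal_pow (r * prod D UNIV) q
    = ennreal_pow (ennreal m * ennreal_pow (prod D UNIV) p) (q / p)"
    using p m by (simp add: ennreal_pow_mult ennreal_pow_pow r_def powr_powr)
  ultimately show ?thesis
    by (simp add: ennreal_pow_mult[of "2 ^ CARD('m) * K"] U_def m N_def D_def)
qed simp

text \<open>Moves the weight into the function, so that an unweighted bound applied to
  \<open>f * w\<close> becomes a weighted bound for \<open>f\<close>.\<close>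

lemma wnorm_mult_weight:
  assumes "\<And>x. 0 \<le> w x"
  shows "wnorm (\<lambda>_. 1) r (\<lambda>x. ennreal \<bar>f x * w x\<bar>) = wnorm w r (\<lambda>x. ennreal \<bar>f x\<bar>)"
  using assms unfolding wnorm_def
  by (intro arg_cong2[where f = ennreal_pow] nn_integral_cong refl)
    (simp add: abs_mult ennreal_mult ennreal_pow_mult)

theorem theorem2p6:
  fixes P :: "'m::finite \<Rightarrow> real" and p q :: real
    and A B C :: "'m \<Rightarrow> real \<Rightarrow> real"
    and \<phi> :: "real \<Rightarrow> real"
    and \<B> :: "(real ^ 'n) set set"
    and w :: "'m \<Rightarrow> real ^ 'n \<Rightarrow> real" and v :: "real ^ 'n \<Rightarrow> real"
  assumes "\<And>i. 1 < P i"
    and "1 / p = (\<Sum>i\<in>UNIV. 1 / P i)"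
    and "0 < p" and "p \<le> q"
    and "\<And>i. young_function (A i)" and "\<And>i. young_function (B i)" and "\<And>i. young_function (C i)"
    and "\<And>i t. t > 0 \<Longrightarrow>
           the_inv_into {0..} (A i) t * the_inv_into {0..} (C i) t \<le> the_inv_into {0..} (B i) t"
    and "\<And>t. t > 0 \<Longrightarrow> \<phi> t > 0"
    and "ess_nondecreasing \<phi>"
    and "((\<lambda>t. \<phi> t / t) \<longlongrightarrow> 0) at_top"
    and "basis \<B>"
    and "multi_bounded (multi_maximal \<B> (\<lambda>_. 1) C) P (\<lambda>_ _. 1) p (\<lambda>_. 1)"
    and "\<And>i. weight \<B> (w i)"
    and "v \<in> borel_measurable lebesgue" and "\<And>x. 0 \<le> v x"
    and "weight \<B> (\<lambda>x. v x powr q)"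
    and "\<exists>\<gamma>. 0 < \<gamma> \<and> \<gamma> < 1 \<and> tauberian \<B> \<gamma> (\<lambda>x. v x powr q)"
    and "(SUP S\<in>\<B>. ennreal (\<phi> (measure lebesgue S)) *
            ennreal (measure lebesgue S powr (1 / q - 1 / p)) *
            ennreal_pow (avg (\<lambda>x. ennreal (v x powr q)) S) (1 / q) *
            (\<Prod>i\<in>UNIV. orlicz_norm (A i) (\<lambda>x. inverse (ennreal (w i x))) S)) < \<infinity>"
  shows "multi_bounded (multi_maximal \<B> \<phi> B) P w q v"
proof -
  define K where "K = (SUP S\<in>\<B>. ennreal (\<phi> (measure lebesgue S)) *
            ennreal (measure lebesgue S powr (1 / q - 1 / p)) *
            ennreal_pow (avg (\<lambda>x. ennreal (v x powr q)) S) (1 / q) *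
            (\<Prod>i\<in>UNIV. orlicz_norm (A i) (\<lambda>x. inverse (ennreal (w i x))) S))"
  have K: "K < \<infinity>" unfolding K_def by fact
  have q: "0 < q" using assms(3,4) by simp
  have w: "w i \<in> borel_measurable lebesgue" "0 \<le> w i x" for i x
    using assms(14) by (auto simp: weight_def)
  have vq[measurable]: "(\<lambda>x. ennreal (v x powr q)) \<in> borel_measurable lebesgue"
    using assms(17) by (simp add: weight_def)
  obtain \<gamma> c where \<gamma>: "0 < \<gamma>" "\<gamma> < 1"
    and taub: "\<And>E. E \<in> sets lebesgue \<Longrightarrow>
      (\<integral>\<^sup>+x\<in>{x. maximal_op \<B> (indicator E) x > ennreal \<gamma>}. ennreal (v x powr q) \<partial>lebesgue)
        \<le> ennreal c * (\<integral>\<^sup>+x\<in>E. ennreal (v x powr q) \<partial>lebesgue)"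
    using assms(18) unfolding tauberian_def by blast
  obtain c' where "0 \<le> c'" and bdd: "\<And>g. (\<And>i. g i \<in> borel_measurable lebesgue) \<Longrightarrow>
      wnorm (\<lambda>_. 1) p (multi_maximal \<B> (\<lambda>_. 1) C g)
        \<le> ennreal c' * (\<Prod>i\<in>UNIV. wnorm (\<lambda>_. 1) (P i) (\<lambda>x. ennreal \<bar>g i x\<bar>))"
    using assms(13) unfolding multi_bounded_def by blast
  \<comment> \<open>The \<open>q\<close>-th root of the constant of
    \<open>tauberian_strong_type\<close> for \<open>s = q / p\<close>. It is independent of
    \<open>f\<close>, and finite, so \<open>enn2real\<close> loses nothing.\<close>
  define k where "k = ennreal_pow (ennreal c * ennreal_pow (2 ^ CARD('m) * K) q
    * ennreal ((1 / (1 - \<gamma>)) powr (q / p))) (1 / q)"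
  have "k < top"
    using K by (simp add: k_def less_top[symmetric] ennreal_mult_eq_top_iff power_eq_top_ennreal)
  have main: "wnorm v q (multi_maximal \<B> \<phi> B f)
      \<le> ennreal (enn2real k * c') * (\<Prod>i\<in>UNIV. wnorm (w i) (P i) (\<lambda>x. ennreal \<bar>f i x\<bar>))"
    if f: "\<And>i. f i \<in> borel_measurable lebesgue" for f
  proof -
    \<comment> \<open>The assumed bound for the operator with \<open>C\<close> is applied to these
      products.\<close>
    define g where "g i x = f i x * w i x" for i x
    have g: "g i \<in> borel_measurable lebesgue" for i
      unfolding g_def using f w by (intro borel_measurable_times)
    define l where "l S = ennreal_pow (ennreal (\<phi> (measure lebesgue S)) *
      (\<Prod>i\<in>UNIV. orlicz_norm (B i) (\<lambda>y. ennreal \<bar>f i y\<bar>) S)) q" for S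
    define d where "d S = ennreal_pow (\<Prod>i\<in>UNIV. orlicz_norm (C i) (\<lambda>y. ennreal \<bar>g i y\<bar>) S) p" for S
    have bound: "l S * (\<integral>\<^sup>+x\<in>S. ennreal (v x powr q) \<partial>lebesgue)
        \<le> ennreal_pow (2 ^ CARD('m) * K) q * ennreal_pow (emeasure lebesgue S * d S) (q / p)"
      if S: "S \<in> \<B>" "S \<noteq> {}" for S
    proof -
      note S' = basisD[OF assms(12) S(1)]
      have ne: "emeasure lebesgue S \<noteq> 0" by (rule emeasure_lebesgue_open_neq_0[OF S'(1) S(2)])
      then have "0 < measure lebesgue S"
        using S'(3) by (simp add: measure_def enn2real_positive_iff zero_less_iff_neq_zero)
      then have a: "ennreal (\<phi> (measure lebesgue S)) \<noteq> 0"
        using assms(9) by (simp add: ennreal_eq_0_iff not_le)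
      show ?thesis
        unfolding l_def d_def g_def
      proof (rule orlicz_ball_estimate[OF assms(3) q assms(5-8) f w S'(2,3) ne a K])
        show "ennreal (\<phi> (measure lebesgue S)) *
            ennreal (measure lebesgue S powr (1 / q - 1 / p)) *
            ennreal_pow (avg (\<lambda>x. ennreal (v x powr q)) S) (1 / q) *
            (\<Prod>i\<in>UNIV. orlicz_norm (A i) (\<lambda>x. inverse (ennreal (w i x))) S) \<le> K"
          unfolding K_def by (rule SUP_upper[OF S(1)])
      qed
    qed
    have "(\<integral>\<^sup>+x. ennreal_pow (multi_maximal \<B> \<phi> B f x) q * ennreal (v x powr q) \<partial>lebesgue)
      \<le> (\<integral>\<^sup>+x. (SUP S\<in>{S\<in>\<B>. x \<in> S}. l S) * ennreal (v x powr q) \<partial>lebesgue)"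
      unfolding multi_maximal_def l_def
      by (intro nn_integral_mono mult_right_mono ennreal_pow_SUP_le q) simp
    also have "\<dots> \<le> ennreal c * ennreal_pow (2 ^ CARD('m) * K) q * ennreal ((1 / (1 - \<gamma>)) powr (q / p))
        * ennreal_pow (\<integral>\<^sup>+x. (SUP S\<in>{S\<in>\<B>. x \<in> S}. d S) \<partial>lebesgue) (q / p)"
      using assms(3,4) by (intro tauberian_strong_type[OF assms(12) \<gamma> vq taub _ bound]) auto
    finally have "wnorm v q (multi_maximal \<B> \<phi> B f) \<le> ennreal_pow (
        ennreal c * ennreal_pow (2 ^ CARD('m) * K) q * ennreal ((1 / (1 - \<gamma>)) powr (q / p))
        * ennreal_pow (\<integral>\<^sup>+x. (SUP S\<in>{S\<in>\<B>. x \<in> S}. d S) \<partial>lebesgue) (q / p)) (1 / q)"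
      unfolding wnorm_def using q by (intro ennreal_pow_mono) auto
    \<comment> \<open>The \<open>q\<close>-th root turns the exponent \<open>q / p\<close> into
      \<open>1 / p\<close>, the exponent of the unweighted norm that follows.\<close>
    also have "\<dots> = k * ennreal_pow (\<integral>\<^sup>+x. (SUP S\<in>{S\<in>\<B>. x \<in> S}. d S) \<partial>lebesgue) (1 / p)"
      using q by (subst ennreal_pow_mult) (simp add: k_def ennreal_pow_pow)
    also have "\<dots> \<le> k * wnorm (\<lambda>_. 1) p (multi_maximal \<B> (\<lambda>_. 1) C g)"
    proof -
      have "(SUP S\<in>{S\<in>\<B>. x \<in> S}. d S) \<le> ennreal_pow (multi_maximal \<B> (\<lambda>_. 1) C g x) p" for x
        unfolding d_def multi_maximal_def using assms(3)
        by (intro SUP_least ennreal_pow_mono) (auto intro: SUP_upper)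
      then show ?thesis
        unfolding wnorm_def using assms(3)
        by (intro mult_left_mono ennreal_pow_mono nn_integral_mono) auto
    qed
    also have "\<dots> \<le> k * (ennreal c' * (\<Prod>i\<in>UNIV. wnorm (\<lambda>_. 1) (P i) (\<lambda>x. ennreal \<bar>g i x\<bar>)))"
      by (intro mult_left_mono bdd g) simp
    also have "\<dots> = ennreal (enn2real k * c') * (\<Prod>i\<in>UNIV. wnorm (w i) (P i) (\<lambda>x. ennreal \<bar>f i x\<bar>))"
      using \<open>k < top\<close> \<open>0 \<le> c'\<close> w(2)
      by (simp add: g_def wnorm_mult_weight ennreal_mult mult.assoc)
    finally show ?thesis .
  qed
  show ?thesis
    unfolding multi_bounded_def
    using main \<open>0 \<le> c'\<close> by (intro exI[of _ "enn2real k * c'"]) auto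
qed

end
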